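(* There exist countable $\omega$-categorical structures $\mathcal{A}$ and $\mathcal{B}$ such that the polymorphism clones $\operatorname{Pol}(\mathcal{A})$ and $\operatorname{Pol}(\mathcal{B})$ are isomorphic as clones, but are not topologically isomorphic, i.e., no clone isomorphism $\operatorname{Pol}(\mathcal{A}) \to \operatorname{Pol}(\mathcal{B})$ is a homeomorphism.
   Context: A countable structure $\mathcal{A}$ is $\omega$-categorical if all countable models of its first-order theory are isomorphic; equivalently, $\operatorname{Aut}(\mathcal{A})$ has for every $k\ge 1$ only finitely many orbits on $k$-tuples of elements of $\mathcal{A}$. $\operatorname{Pol}(\mathcal{A})$ is the set of all homomorphisms from $\mathcal{A}^k$ to $\mathcal{A}$, for all $k \geq 1$. It is a function clone on the domain $X$ of $\mathcal{A}$: a subset of $O(X) := \bigcup_{k\ge 1} X^{X^k}$ containing all projections and closed under composition. Each $X^{X^k}$ carries the product topology ($X$ discrete), $O(X)$ carries the sum topology, and function clones carry the subspace topology. A clone homomorphism between function clones $\Gamma$ and $\Delta$ is an (arity-preserving) map $\xi:\Gamma\to\Delta$ such that $\xi(f(g_1,\dots,g_n)) = \xi(f)(\xi(g_1),\dots,\xi(g_n))$ for all $f,g_1,\dots,g_n\in\Gamma$ for which the composition makes sense ($f$ $n$-ary, the $g_i$ of equal arity). A clone isomorphism is a bijective clone homomorphism. *)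

theory Defs
  imports "HOL-Analysis.Analysis"
begin

section \<open>First-order structures\<close>

record ('f, 'r) signature =
  fsyms :: "'f set"
  farity :: "'f \<Rightarrow> nat"
  rsyms :: "'r set"
  rarity :: "'r \<Rightarrow> nat"

record ('f, 'r, 'a) struct =
  universe :: "'a set"
  fint :: "'f \<Rightarrow> 'a list \<Rightarrow> 'a"
  rint :: "'r \<Rightarrow> 'a list set"

definition structure_over :: "('f, 'r) signature \<Rightarrow> ('f, 'r, 'a) struct \<Rightarrow> bool" where
  "structure_over S A \<longleftrightarrow>
     universe A \<noteq> {} \<and>
     (\<forall>g \<in> fsyms S. \<forall>xs \<in> lists (universe A). length xs = farity S g \<longrightarrow> fint A g xs \<in> universe A) \<and>
     (\<forall>r \<in> rsyms S. rint A r \<subseteq> {xs \<in> lists (universe A). length xs = rarity S r})"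

text \<open>A countable structure has a countable (possibly finite) domain and a countable signature.\<close>

definition countable_structure :: "('f, 'r) signature \<Rightarrow> ('f, 'r, 'a) struct \<Rightarrow> bool" where
  "countable_structure S A \<longleftrightarrow>
     structure_over S A \<and> countable (universe A) \<and> countable (fsyms S) \<and> countable (rsyms S)"

text \<open>Homomorphisms are kept extensional, so that two of them are equal iff they agree on the
  domain of the source structure.\<close>

definition homs ::
  "('f, 'r) signature \<Rightarrow> ('f, 'r, 'a) struct \<Rightarrow> ('f, 'r, 'b) struct \<Rightarrow> ('a \<Rightarrow> 'b) set" where
  "homs S A B = {h \<in> universe A \<rightarrow>\<^sub>E universe B.
     (\<forall>g \<in> fsyms S. \<forall>xs \<in> lists (universe A). length xs = farity S g \<longrightarrow>
        h (fint A g xs) = fint B g (map h xs)) \<and>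
     (\<forall>r \<in> rsyms S. \<forall>xs \<in> rint A r. map h xs \<in> rint B r)}"

definition isomorphic_structs ::
  "('f, 'r) signature \<Rightarrow> ('f, 'r, 'a) struct \<Rightarrow> ('f, 'r, 'b) struct \<Rightarrow> bool" where
  "isomorphic_structs S A B \<longleftrightarrow>
     (\<exists>h \<in> homs S A B. bij_betw h (universe A) (universe B) \<and>
        (\<forall>r \<in> rsyms S. \<forall>xs \<in> lists (universe A). length xs = rarity S r \<longrightarrow>
           map h xs \<in> rint B r \<longrightarrow> xs \<in> rint A r))"

section \<open>First-order logic with equality\<close>

datatype 'f fterm = Var nat | App 'f "'f fterm list"

datatype ('f, 'r) form =
    Eq "'f fterm" "'f fterm"
  | Rel 'r "'f fterm list"
  | Neg "('f, 'r) form"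
  | Conj "('f, 'r) form" "('f, 'r) form"
  | Exi nat "('f, 'r) form"

primrec tvars :: "'f fterm \<Rightarrow> nat set" where
  "tvars (Var i) = {i}"
| "tvars (App g ts) = \<Union> (set (map tvars ts))"

primrec fvars :: "('f, 'r) form \<Rightarrow> nat set" where
  "fvars (Eq s t) = tvars s \<union> tvars t"
| "fvars (Rel r ts) = \<Union> (set (map tvars ts))"
| "fvars (Neg p) = fvars p"
| "fvars (Conj p q) = fvars p \<union> fvars q"
| "fvars (Exi i p) = fvars p - {i}"

primrec wf_term :: "('f, 'r) signature \<Rightarrow> 'f fterm \<Rightarrow> bool" where
  "wf_term S (Var i) \<longleftrightarrow> True"
| "wf_term S (App g ts) \<longleftrightarrow>
     g \<in> fsyms S \<and> length ts = farity S g \<and> list_all (\<lambda>b. b) (map (wf_term S) ts)"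

primrec wf_form :: "('f, 'r) signature \<Rightarrow> ('f, 'r) form \<Rightarrow> bool" where
  "wf_form S (Eq s t) \<longleftrightarrow> wf_term S s \<and> wf_term S t"
| "wf_form S (Rel r ts) \<longleftrightarrow> r \<in> rsyms S \<and> length ts = rarity S r \<and> list_all (wf_term S) ts"
| "wf_form S (Neg p) \<longleftrightarrow> wf_form S p"
| "wf_form S (Conj p q) \<longleftrightarrow> wf_form S p \<and> wf_form S q"
| "wf_form S (Exi i p) \<longleftrightarrow> wf_form S p"

primrec tval :: "('f, 'r, 'a) struct \<Rightarrow> (nat \<Rightarrow> 'a) \<Rightarrow> 'f fterm \<Rightarrow> 'a" where
  "tval A e (Var i) = e i"
| "tval A e (App g ts) = fint A g (map (tval A e) ts)"

primrec sat :: "('f, 'r, 'a) struct \<Rightarrow> (nat \<Rightarrow> 'a) \<Rightarrow> ('f, 'r) form \<Rightarrow> bool" where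
  "sat A e (Eq s t) \<longleftrightarrow> tval A e s = tval A e t"
| "sat A e (Rel r ts) \<longleftrightarrow> map (tval A e) ts \<in> rint A r"
| "sat A e (Neg p) \<longleftrightarrow> \<not> sat A e p"
| "sat A e (Conj p q) \<longleftrightarrow> sat A e p \<and> sat A e q"
| "sat A e (Exi i p) \<longleftrightarrow> (\<exists>a \<in> universe A. sat A (e(i := a)) p)"

definition sentences :: "('f, 'r) signature \<Rightarrow> ('f, 'r) form set" where
  "sentences S = {p. wf_form S p \<and> fvars p = {}}"

definition models :: "('f, 'r, 'a) struct \<Rightarrow> ('f, 'r) form \<Rightarrow> bool" where
  "models A p \<longleftrightarrow> (\<forall>e. range e \<subseteq> universe A \<longrightarrow> sat A e p)"

definition theory_of :: "('f, 'r) signature \<Rightarrow> ('f, 'r, 'a) struct \<Rightarrow> ('f, 'r) form set" where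
  "theory_of S A = {p \<in> sentences S. models A p}"

definition is_model ::
  "('f, 'r) signature \<Rightarrow> ('f, 'r) form set \<Rightarrow> ('f, 'r, 'a) struct \<Rightarrow> bool" where
  "is_model S T M \<longleftrightarrow> structure_over S M \<and> (\<forall>p \<in> T. models M p)"

text \<open>Quantifying over the models whose domain is a set of natural numbers loses nothing: every
  countable structure is isomorphic to one of these.\<close>

definition omega_categorical :: "('f, 'r) signature \<Rightarrow> ('f, 'r, 'a) struct \<Rightarrow> bool" where
  "omega_categorical S A \<longleftrightarrow>
     (\<forall>(M :: ('f, 'r, nat) struct) (N :: ('f, 'r, nat) struct).
        is_model S (theory_of S A) M \<longrightarrow> is_model S (theory_of S A) N \<longrightarrow>
        isomorphic_structs S M N)"

section \<open>Function clones\<close>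

text \<open>\<^term>\<open>tuples k X\<close> is $X^k$. A \<open>k\<close>-ary operation on \<open>X\<close> is an extensional function
  $X^k \to X$ tagged with its arity, so that $O(X)$ is literally a disjoint sum.\<close>

definition tuples :: "nat \<Rightarrow> 'a set \<Rightarrow> (nat \<Rightarrow> 'a) set" where
  "tuples k X = {..<k} \<rightarrow>\<^sub>E X"

type_synonym 'a operation = "nat \<times> ((nat \<Rightarrow> 'a) \<Rightarrow> 'a)"

definition operations :: "'a set \<Rightarrow> 'a operation set" where
  "operations X = (SIGMA k : {1..}. tuples k X \<rightarrow>\<^sub>E X)"

definition operations_topology :: "'a set \<Rightarrow> 'a operation topology" where
  "operations_topology X =
     sum_topology (\<lambda>k. product_topology (\<lambda>_. discrete_topology X) (tuples k X)) {1..}"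

lemma topspace_operations_topology: "topspace (operations_topology X) = operations X"
  by (auto simp: operations_topology_def operations_def)

definition clone_topology :: "'a set \<Rightarrow> 'a operation set \<Rightarrow> 'a operation topology" where
  "clone_topology X C = subtopology (operations_topology X) C"

definition proj_op :: "'a set \<Rightarrow> nat \<Rightarrow> nat \<Rightarrow> 'a operation" where
  "proj_op X k i = (k, \<lambda>x \<in> tuples k X. x i)"

text \<open>\<^term>\<open>compose_op X m F G\<close> is $f(g_0,\dots,g_{n-1})$, where $f$ is the $n$-ary operation
  \<open>F\<close> and $g_i$ is the $m$-ary operation \<open>G i\<close>.\<close>

definition compose_op ::
  "'a set \<Rightarrow> nat \<Rightarrow> 'a operation \<Rightarrow> (nat \<Rightarrow> 'a operation) \<Rightarrow> 'a operation" where
  "compose_op X m F G = (m, \<lambda>x \<in> tuples m X. snd F (\<lambda>i \<in> {..<fst F}. snd (G i) x))"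

definition function_clone :: "'a set \<Rightarrow> 'a operation set \<Rightarrow> bool" where
  "function_clone X C \<longleftrightarrow>
     C \<subseteq> operations X \<and>
     (\<forall>k \<ge> 1. \<forall>i < k. proj_op X k i \<in> C) \<and>
     (\<forall>m. \<forall>F \<in> C. \<forall>G. (\<forall>i < fst F. G i \<in> C \<and> fst (G i) = m) \<longrightarrow> compose_op X m F G \<in> C)"

definition clone_hom ::
  "'a set \<Rightarrow> 'a operation set \<Rightarrow> 'b set \<Rightarrow> 'b operation set \<Rightarrow> ('a operation \<Rightarrow> 'b operation) \<Rightarrow> bool"
  where
  "clone_hom X C Y D \<xi> \<longleftrightarrow>
     \<xi> \<in> C \<rightarrow> D \<and>
     (\<forall>F \<in> C. fst (\<xi> F) = fst F) \<and>
     (\<forall>m. \<forall>F \<in> C. \<forall>G. (\<forall>i < fst F. G i \<in> C \<and> fst (G i) = m) \<longrightarrow>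
        \<xi> (compose_op X m F G) = compose_op Y m (\<xi> F) (\<lambda>i. \<xi> (G i)))"

definition clone_iso ::
  "'a set \<Rightarrow> 'a operation set \<Rightarrow> 'b set \<Rightarrow> 'b operation set \<Rightarrow> ('a operation \<Rightarrow> 'b operation) \<Rightarrow> bool"
  where
  "clone_iso X C Y D \<xi> \<longleftrightarrow> clone_hom X C Y D \<xi> \<and> bij_betw \<xi> C D"

section \<open>Polymorphism clones\<close>

definition power_struct :: "nat \<Rightarrow> ('f, 'r, 'a) struct \<Rightarrow> ('f, 'r, nat \<Rightarrow> 'a) struct" where
  "power_struct k A = \<lparr>
     universe = tuples k (universe A),
     fint = (\<lambda>g ts. \<lambda>i \<in> {..<k}. fint A g (map (\<lambda>t. t i) ts)),
     rint = (\<lambda>r. {ts \<in> lists (tuples k (universe A)). \<forall>i < k. map (\<lambda>t. t i) ts \<in> rint A r})\<rparr>"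

definition Pol :: "('f, 'r) signature \<Rightarrow> ('f, 'r, 'a) struct \<Rightarrow> 'a operation set" where
  "Pol S A = (SIGMA k : {1..}. homs S (power_struct k A) A)"

lemma function_clone_Pol:
  assumes "structure_over S A"
  shows "function_clone (universe A) (Pol S A)"
proof -
  let ?X = "universe A"
  have proj: "proj_op ?X k i \<in> Pol S A" if "1 \<le> k" "i < k" for k i
  proof -
    let ?p = "\<lambda>x \<in> tuples k ?X. x i"
    have mp: "map ?p xs = map (\<lambda>t. t i) xs" if "xs \<in> lists (tuples k ?X)" for xs
      using that by (intro map_cong) (auto simp: in_lists_conv_set)
    have "?p \<in> tuples k ?X \<rightarrow>\<^sub>E ?X"
      using that by (auto simp: tuples_def PiE_def Pi_def)
    moreover have "?p (fint (power_struct k A) g xs) = fint A g (map ?p xs)"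
      if g: "g \<in> fsyms S" and xs: "xs \<in> lists (tuples k ?X)" and len: "length xs = farity S g" for g xs
    proof -
      have "fint A g (map (\<lambda>t. t j) xs) \<in> ?X" if "j < k" for j
      proof -
        have "map (\<lambda>t. t j) xs \<in> lists ?X"
          using xs that by (auto simp: tuples_def in_lists_conv_set PiE_def Pi_def)
        then show ?thesis
          using assms g len unfolding structure_over_def by simp
      qed
      then have "fint (power_struct k A) g xs \<in> tuples k ?X"
        by (auto simp: power_struct_def tuples_def)
      then have "?p (fint (power_struct k A) g xs) = fint A g (map (\<lambda>t. t i) xs)"
        using that \<open>i < k\<close> by (simp add: power_struct_def)
      then show ?thesis
        by (simp only: mp[OF xs])
    qed
    moreover have "map ?p xs \<in> rint A r" if "xs \<in> rint (power_struct k A) r" for r xs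
    proof -
      have "xs \<in> lists (tuples k ?X)" "map (\<lambda>t. t i) xs \<in> rint A r"
        using that \<open>i < k\<close> unfolding power_struct_def by auto
      then show ?thesis
        by (simp only: mp)
    qed
    ultimately have "?p \<in> homs S (power_struct k A) A"
      by (simp add: homs_def power_struct_def)
    then show ?thesis
      using that by (simp add: Pol_def proj_op_def)
  qed
  have comp: "compose_op ?X m F G \<in> Pol S A"
    if F: "F \<in> Pol S A" and G: "\<And>i. i < fst F \<Longrightarrow> G i \<in> Pol S A \<and> fst (G i) = m" for m F G
  proof -
    define n where "n = fst F"
    define f where "f = snd F"
    define g where "g = (\<lambda>i. snd (G i))"
    have n: "1 \<le> n" and f: "f \<in> homs S (power_struct n A) A"
      using F by (auto simp: Pol_def n_def f_def)
    have g: "g i \<in> homs S (power_struct m A) A" if "i < n" for i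
      using G[of i] that by (auto simp: Pol_def n_def g_def)
    have m: "1 \<le> m"
      using G[of 0] n by (auto simp: Pol_def n_def)
    have fX: "f y \<in> ?X" if "y \<in> tuples n ?X" for y
    proof -
      have "f \<in> tuples n ?X \<rightarrow>\<^sub>E ?X"
        using f by (simp add: homs_def power_struct_def)
      with that show ?thesis
        by (rule PiE_mem[rotated])
    qed
    have gX: "g i x \<in> ?X" if "i < n" "x \<in> tuples m ?X" for i x
    proof -
      have "g i \<in> tuples m ?X \<rightarrow>\<^sub>E ?X"
        using g[OF that(1)] by (simp add: homs_def power_struct_def)
      with that(2) show ?thesis
        by (rule PiE_mem[rotated])
    qed
    define t where "t = (\<lambda>x. \<lambda>i \<in> {..<n}. g i x)"
    let ?h = "\<lambda>x \<in> tuples m ?X. f (t x)"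
    have t: "t x \<in> tuples n ?X" if "x \<in> tuples m ?X" for x
      using that gX by (auto simp: t_def tuples_def[of n])
    have mh: "map ?h xs = map f (map t xs)" if "xs \<in> lists (tuples m ?X)" for xs
      using that by (auto simp: in_lists_conv_set)
    have mt: "map t xs \<in> lists (tuples n ?X)" if "xs \<in> lists (tuples m ?X)" for xs
      using that t by (auto simp: in_lists_conv_set)
    have mti: "map (\<lambda>y. y i) (map t xs) = map (g i) xs" if "i < n" for i xs
      using that by (simp add: t_def)
    have "?h \<in> tuples m ?X \<rightarrow>\<^sub>E ?X"
      using fX t by auto
    moreover have "?h (fint (power_struct m A) s xs) = fint A s (map ?h xs)"
      if s: "s \<in> fsyms S" and xs: "xs \<in> lists (tuples m ?X)" and len: "length xs = farity S s" for s xs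
    proof -
      let ?y = "fint (power_struct m A) s xs"
      have "fint A s (map (\<lambda>t. t j) xs) \<in> ?X" if "j < m" for j
      proof -
        have "map (\<lambda>t. t j) xs \<in> lists ?X"
          using xs that by (auto simp: tuples_def in_lists_conv_set PiE_def Pi_def)
        then show ?thesis
          using assms s len unfolding structure_over_def by simp
      qed
      then have y: "?y \<in> tuples m ?X"
        by (auto simp: power_struct_def tuples_def)
      have "g i ?y = fint A s (map (g i) xs)" if "i < n" for i
        using g[OF that] s xs len by (simp add: homs_def power_struct_def)
      then have "t ?y = fint (power_struct n A) s (map t xs)"
        unfolding t_def by (auto simp: power_struct_def o_def restrict_def fun_eq_iff)
      moreover have "f (fint (power_struct n A) s (map t xs)) = fint A s (map f (map t xs))"
        using f s len mt[OF xs] by (simp add: homs_def power_struct_def del: map_map)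
      ultimately show ?thesis
        using y by (simp only: mh[OF xs] restrict_apply')
    qed
    moreover have "map ?h xs \<in> rint A r" if r: "r \<in> rsyms S" and "xs \<in> rint (power_struct m A) r" for r xs
    proof -
      have xs: "xs \<in> lists (tuples m ?X)"
        using that by (simp add: power_struct_def)
      have "map (\<lambda>y. y i) (map t xs) \<in> rint A r" if "i < n" for i
        unfolding mti[OF that] using g[OF that] r \<open>xs \<in> rint (power_struct m A) r\<close>
        by (simp add: homs_def)
      then have "map t xs \<in> rint (power_struct n A) r"
        using mt[OF xs] by (simp add: power_struct_def)
      then have "map f (map t xs) \<in> rint A r"
        using f r by (simp only: homs_def mem_Collect_eq)
      then show ?thesis
        by (simp only: mh[OF xs])
    qed
    ultimately have "?h \<in> homs S (power_struct m A) A"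
      by (simp add: homs_def power_struct_def)
    moreover have "compose_op ?X m F G = (m, ?h)"
      by (simp add: compose_op_def t_def n_def f_def g_def)
    ultimately show ?thesis
      using m by (simp add: Pol_def)
  qed
  have "Pol S A \<subseteq> operations ?X"
    by (auto simp: Pol_def operations_def homs_def power_struct_def)
  then show ?thesis
    using proj comp unfolding function_clone_def by blast
qed

end

theory Submission
  imports Defs "HOL-Library.Z2" "HOL-Library.Function_Algebras"
begin

text \<open>
  Let \<open>G\<close> be the profinite group of pairs \<open>(v, a)\<close>, where \<open>v\<close> is a sequence and \<open>a\<close> an infinite
  matrix over the field with two elements, with product \<open>(v, a) (w, b) = (v + w, a + b + v \<otimes> w)\<close>, and
  let \<open>z\<close> be the central involution given by the identity matrix. Products of squares are sums of
  rank-one matrices \<open>v \<otimes> v\<close>; so \<open>z\<close> is a limit of products of squares but not one itself, and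
  some discontinuous homomorphism from \<open>G\<close> to the group with two elements does not kill \<open>z\<close>, while
  every continuous one does. Thus \<open>G\<close> is abstractly, but not topologically, the product of
  \<open>G/\<langle>z\<rangle>\<close> and \<open>\<langle>z\<rangle>\<close>.

  To pass to \<open>\<omega>\<close>-categorical structures, lists of points of a countable set are coloured by elements
  of \<open>G/\<langle>z\<rangle>\<close>, up to a precision that grows with the length of the list. The colouring is generic, hence
  has an oligomorphic automorphism group, and it is equivariant for an action of \<open>G\<close>. The monoid of
  self-embeddings that shift all colours by an element of \<open>G/\<langle>z\<rangle>\<close> is then covered in two ways:
  by adding four points on which \<open>G\<close> acts through a continuous homomorphism to the integers modulo 4
  that does not kill \<open>z\<close>, or by adding two points that may be swapped freely. The discontinuous
  homomorphism yields an abstract isomorphism of the covers. Any isomorphism maps \<open>z\<close>, acting trivially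
  on the coloured points, to the central swap; it cannot be continuous, because \<open>z\<close> is a limit of
  products of squares and squares do not swap the two points. Finally, both closed monoids are the
  unary parts of polymorphism clones all of whose operations are essentially unary.
\<close>

section \<open>Finitely many orbits of tuples imply \<open>\<omega>\<close>-categoricity\<close>

text \<open>Stage \<open>n\<close> treats the \<open>n\<close>-th point of \<open>X\<close> and the
  \<open>n\<close>-th point of \<open>Y\<close>. \<open>P\<close> need not pass to sublists, so the
  last conclusion covers a finite part of \<open>R\<close> by a list with \<open>P\<close>. Applied
  to pairs of models and to colour-preserving finite maps.\<close>

lemma back_and_forth:
  fixes P :: "('a \<times> 'b) list \<Rightarrow> bool"
  assumes X: "countable X" "X \<noteq> {}" and Y: "countable Y" "Y \<noteq> {}"
    and start: "P l0" "set l0 \<subseteq> X \<times> Y"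
    and fwd: "\<And>l x. P l \<Longrightarrow> set l \<subseteq> X \<times> Y \<Longrightarrow> x \<in> X \<Longrightarrow> \<exists>y\<in>Y. P (l @ [(x, y)])"
    and bwd: "\<And>l y. P l \<Longrightarrow> set l \<subseteq> X \<times> Y \<Longrightarrow> y \<in> Y \<Longrightarrow> \<exists>x\<in>X. P (l @ [(x, y)])"
  obtains R where "R \<subseteq> X \<times> Y" "set l0 \<subseteq> R" "fst ` R = X" "snd ` R = Y"
    "\<And>F. finite F \<Longrightarrow> F \<subseteq> R \<Longrightarrow> \<exists>l. P l \<and> F \<subseteq> set l \<and> set l \<subseteq> R"
proof -
  define ok where "ok l \<longleftrightarrow> P l \<and> set l \<subseteq> X \<times> Y" for l
  have "\<exists>l'. ok l' \<and> set l \<subseteq> set l' \<and> from_nat_into X n \<in> fst ` set l' \<and>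
      from_nat_into Y n \<in> snd ` set l'" if okl: "ok l" for l n
  proof -
    have x: "from_nat_into X n \<in> X" and y: "from_nat_into Y n \<in> Y"
      using X Y by (auto intro: from_nat_into)
    obtain y' where 1: "y' \<in> Y" "P (l @ [(from_nat_into X n, y')])"
      using fwd[OF _ _ x, of l] okl unfolding ok_def by blast
    obtain x' where 2: "x' \<in> X" "P ((l @ [(from_nat_into X n, y')]) @ [(x', from_nat_into Y n)])"
      using bwd[OF 1(2) _ y] 1 x okl unfolding ok_def by auto
    show ?thesis
      by (rule exI[of _ "(l @ [(from_nat_into X n, y')]) @ [(x', from_nat_into Y n)]"])
        (use okl 1 2 x y in \<open>auto simp: ok_def\<close>)
  qed
  then obtain nx where nx: "\<And>l n. ok l \<Longrightarrow> ok (nx l n)" "\<And>l n. ok l \<Longrightarrow> set l \<subseteq> set (nx l n)"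
      "\<And>l n. ok l \<Longrightarrow> from_nat_into X n \<in> fst ` set (nx l n)"
      "\<And>l n. ok l \<Longrightarrow> from_nat_into Y n \<in> snd ` set (nx l n)"
    by metis
  define L where "L = rec_nat l0 (\<lambda>n l. nx l n)"
  have LS: "L (Suc n) = nx (L n) n" and L0: "L 0 = l0" for n by (simp_all add: L_def)
  have okL: "ok (L n)" for n
    by (induction n) (use start nx(1) in \<open>auto simp: LS L0 ok_def\<close>)
  have mono: "set (L m) \<subseteq> set (L n)" if "m \<le> n" for m n
    using that by (rule lift_Suc_mono_le[rotated]) (simp add: LS nx okL)
  define R where "R = (\<Union>n. set (L n))"
  show ?thesis
  proof (rule that[of R])
    show RXY: "R \<subseteq> X \<times> Y" using okL by (auto simp: R_def ok_def)
    show "set l0 \<subseteq> R" using L0 by (auto simp: R_def)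
    have "x \<in> fst ` R" if xX: "x \<in> X" for x
    proof -
      obtain n where "x = from_nat_into X n"
        using from_nat_into_surj[OF X(1) xX] by metis
      then have "x \<in> fst ` set (L (Suc n))" using nx(3)[OF okL] by (simp add: LS)
      then show ?thesis unfolding R_def by blast
    qed
    then show "fst ` R = X" using RXY by auto
    have "y \<in> snd ` R" if yY: "y \<in> Y" for y
    proof -
      obtain n where "y = from_nat_into Y n"
        using from_nat_into_surj[OF Y(1) yY] by metis
      then have "y \<in> snd ` set (L (Suc n))" using nx(4)[OF okL] by (simp add: LS)
      then show ?thesis unfolding R_def by blast
    qed
    then show "snd ` R = Y" using RXY by auto
    fix F assume "finite F" "F \<subseteq> R"
    then have "\<exists>n. F \<subseteq> set (L n)"
    proof (induction F)
      case (insert x F)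
      then obtain n m where "F \<subseteq> set (L n)" "x \<in> set (L m)" by (auto simp: R_def)
      then have "insert x F \<subseteq> set (L (max m n))"
        using mono[of n "max m n"] mono[of m "max m n"] by auto
      then show ?case by blast
    qed auto
    then show "\<exists>l. P l \<and> F \<subseteq> set l \<and> set l \<subseteq> R"
      using okL by (auto simp: R_def ok_def)
  qed
qed

section \<open>Satisfaction and its invariance under automorphisms\<close>

lemma tval_cong: "(\<And>i. i \<in> tvars t \<Longrightarrow> e i = e' i) \<Longrightarrow> tval A e t = tval A e' t"
proof (induction t)
  case (App g ts)
  have "map (tval A e) ts = map (tval A e') ts"
    by (intro map_cong refl App.IH App.prems) auto
  then show ?case by (simp only: tval.simps)
qed simp

lemma sat_cong: "(\<And>i. i \<in> fvars p \<Longrightarrow> e i = e' i) \<Longrightarrow> sat A e p \<longleftrightarrow> sat A e' p"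
proof (induction p arbitrary: e e')
  case (Eq s t)
  then show ?case using tval_cong[of s e e' A] tval_cong[of t e e' A] by simp
next
  case (Rel r ts)
  have "map (tval A e) ts = map (tval A e') ts"
    using Rel by (intro map_cong refl tval_cong) auto
  then show ?case by (simp only: sat.simps)
next
  case (Neg p)
  then show ?case by (metis sat.simps(3) fvars.simps(3))
next
  case (Conj p q)
  then show ?case by (metis sat.simps(4) fvars.simps(4) Un_iff)
next
  case (Exi i p)
  have "sat A (e(i := a)) p \<longleftrightarrow> sat A (e'(i := a)) p" for a
    by (rule Exi.IH) (use Exi.prems in auto)
  then show ?case by simp
qed

lemma tval_in_universe:
  assumes "structure_over S A" "range e \<subseteq> universe A" "wf_term S t"
  shows "tval A e t \<in> universe A"
  using assms(3)
proof (induction t)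
  case (Var i)
  then show ?case using assms(2) by auto
next
  case (App g ts)
  then have "map (tval A e) ts \<in> lists (universe A)" by (auto simp: list_all_iff)
  then show ?case using App.prems assms(1) by (simp add: structure_over_def)
qed

definition automorphism :: "('f, 'r) signature \<Rightarrow> ('f, 'r, 'a) struct \<Rightarrow> ('a \<Rightarrow> 'a) \<Rightarrow> bool" where
  "automorphism S A h \<longleftrightarrow> h \<in> homs S A A \<and> bij_betw h (universe A) (universe A) \<and>
     (\<forall>r \<in> rsyms S. \<forall>xs \<in> lists (universe A). length xs = rarity S r \<longrightarrow>
        map h xs \<in> rint A r \<longrightarrow> xs \<in> rint A r)"

lemma automorphism_rint:
  assumes "automorphism S A h" "r \<in> rsyms S" "xs \<in> lists (universe A)" "length xs = rarity S r"
  shows "map h xs \<in> rint A r \<longleftrightarrow> xs \<in> rint A r"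
  using assms by (auto simp: automorphism_def homs_def)

lemma tval_automorphism:
  assumes "structure_over S A" "automorphism S A h" "range e \<subseteq> universe A" "wf_term S t"
  shows "tval A (\<lambda>i. h (e i)) t = h (tval A e t)"
  using assms(4)
proof (induction t)
  case (App g ts)
  have "map (tval A e) ts \<in> lists (universe A)"
    using App.prems tval_in_universe[OF assms(1,3)] by (auto simp: list_all_iff)
  then have "h (fint A g (map (tval A e) ts)) = fint A g (map h (map (tval A e) ts))"
    using assms(2) App.prems by (simp add: automorphism_def homs_def del: map_map)
  moreover have "map (tval A (\<lambda>i. h (e i))) ts = map h (map (tval A e) ts)"
    using App by (auto simp: list_all_iff)
  ultimately show ?case by (simp only: tval.simps)
qed simp

lemma sat_automorphism:
  assumes "structure_over S A" "automorphism S A h" "range e \<subseteq> universe A" "wf_form S p"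
  shows "sat A (\<lambda>i. h (e i)) p \<longleftrightarrow> sat A e p"
  using assms(3,4)
proof (induction p arbitrary: e)
  case (Eq s t)
  have "inj_on h (universe A)" using assms(2) by (auto simp: automorphism_def bij_betw_def)
  then show ?case
    using Eq tval_in_universe[OF assms(1), of e]
    by (simp add: tval_automorphism[OF assms(1,2)] inj_on_eq_iff)
next
  case (Rel r ts)
  have "map (tval A (\<lambda>i. h (e i))) ts = map h (map (tval A e) ts)"
    using Rel tval_automorphism[OF assms(1,2)] by (auto simp: list_all_iff)
  moreover have "map (tval A e) ts \<in> lists (universe A)"
    using Rel tval_in_universe[OF assms(1)] by (auto simp: list_all_iff)
  ultimately show ?case
    using Rel.prems automorphism_rint[OF assms(2), of r "map (tval A e) ts"]
    by (simp only: sat.simps wf_form.simps length_map)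
next
  case (Exi i p)
  \<comment> \<open>\<open>h\<close> is onto, so every witness has the form
    \<open>h a\<close>.\<close>
  have "(\<exists>a\<in>universe A. sat A ((\<lambda>i. h (e i))(i := a)) p) \<longleftrightarrow>
      (\<exists>a\<in>universe A. sat A ((\<lambda>i. h (e i))(i := h a)) p)"
    using assms(2) unfolding automorphism_def bij_betw_def
    by (metis (no_types, lifting) imageE imageI)
  also have "\<dots> \<longleftrightarrow> (\<exists>a\<in>universe A. sat A (e(i := a)) p)"
  proof (rule bex_cong[OF refl])
    fix a assume a: "a \<in> universe A"
    have rng: "range (e(i := a)) \<subseteq> universe A" using a Exi.prems by auto
    have "(\<lambda>i. h (e i))(i := h a) = (\<lambda>j. h ((e(i := a)) j))" by auto
    then show "sat A ((\<lambda>i. h (e i))(i := h a)) p \<longleftrightarrow> sat A (e(i := a)) p"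
      using Exi.IH[OF rng] Exi.prems by (simp only: wf_form.simps)
  qed
  finally show ?case by simp
qed auto

section \<open>Types of tuples and universal sentences\<close>

definition fm :: "('f, 'r) signature \<Rightarrow> nat \<Rightarrow> ('f, 'r) form set" where
  "fm S n = {p. wf_form S p \<and> fvars p \<subseteq> {..<n}}"

definition tup :: "nat \<Rightarrow> 'a set \<Rightarrow> 'a list set" where
  "tup n X = {xs \<in> lists X. length xs = n}"

text \<open>The complete type of the tuple. As an assignment, \<open>(!) xs\<close> is unspecified
  beyond the length of \<open>xs\<close>; formulas in \<open>fm\<close> do not see these
  values.\<close>

definition tp :: "('f, 'r) signature \<Rightarrow> ('f, 'r, 'a) struct \<Rightarrow> 'a list \<Rightarrow> ('f, 'r) form set" where
  "tp S A xs = {p \<in> fm S (length xs). sat A ((!) xs) p}"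

text \<open>\<open>sat_automorphism\<close> asks for assignments with all values in the universe,
  which \<open>(!) xs\<close> does not guarantee.\<close>

lemma sat_nth_extend:
  assumes "fvars p \<subseteq> {..<length xs}"
  shows "sat A (\<lambda>i. if i < length xs then xs ! i else y) p \<longleftrightarrow> sat A ((!) xs) p"
  by (rule sat_cong) (use assms in auto)

lemma sat_nth_snoc:
  assumes "fvars p \<subseteq> {..length xs}"
  shows "sat A ((!) (xs @ [a])) p \<longleftrightarrow> sat A (((!) xs)(length xs := a)) p"
  by (rule sat_cong) (use assms in \<open>auto simp: nth_append le_less\<close>)

text \<open>A closed tautology: without constant symbols there is no quantifier-free sentence.\<close>

definition truth :: "('f, 'r) form" where
  "truth = Neg (Exi 0 (Neg (Eq (Var 0) (Var 0))))"

fun conjs :: "('f, 'r) form list \<Rightarrow> ('f, 'r) form" where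
  "conjs [] = truth"
| "conjs (p # ps) = Conj p (conjs ps)"

fun alls :: "nat \<Rightarrow> ('f, 'r) form \<Rightarrow> ('f, 'r) form" where
  "alls 0 p = p"
| "alls (Suc n) p = alls n (Neg (Exi n (Neg p)))"

lemma sat_conjs: "sat A e (conjs ps) \<longleftrightarrow> (\<forall>p\<in>set ps. sat A e p)"
  by (induction ps) (auto simp: truth_def)

lemma fm_conjs: "set ps \<subseteq> fm S n \<Longrightarrow> conjs ps \<in> fm S n"
  by (induction ps) (auto simp: truth_def fm_def)

lemma fm_Neg: "p \<in> fm S n \<Longrightarrow> Neg p \<in> fm S n"
  by (auto simp: fm_def)

lemma fm_Exi: "p \<in> fm S (Suc n) \<Longrightarrow> Exi n p \<in> fm S n"
  by (auto simp: fm_def less_Suc_eq)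

lemma alls_sentence: "p \<in> fm S n \<Longrightarrow> alls n p \<in> sentences S"
proof (induction n arbitrary: p)
  case (Suc n)
  have "Neg (Exi n (Neg p)) \<in> fm S n" using Suc.prems by (intro fm_Neg fm_Exi)
  then show ?case using Suc.IH by simp
qed (auto simp: fm_def sentences_def)

lemma sat_alls:
  assumes "p \<in> fm S n"
  shows "sat A e (alls n p) \<longleftrightarrow> (\<forall>xs\<in>tup n (universe A). sat A ((!) xs) p)"
  using assms
proof (induction n arbitrary: p)
  case 0
  have "sat A e p \<longleftrightarrow> sat A ((!) []) p" by (rule sat_cong) (use 0 in \<open>auto simp: fm_def\<close>)
  then show ?case by (auto simp: tup_def)
next
  case (Suc n)
  have q: "Neg (Exi n (Neg p)) \<in> fm S n" using Suc.prems by (intro fm_Neg fm_Exi)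
  have "sat A e (alls (Suc n) p) \<longleftrightarrow>
      (\<forall>xs\<in>tup n (universe A). \<forall>a\<in>universe A. sat A (((!) xs)(n := a)) p)"
    using Suc.IH[OF q] by simp
  also have "\<dots> \<longleftrightarrow> (\<forall>xs\<in>tup n (universe A). \<forall>a\<in>universe A. sat A ((!) (xs @ [a])) p)"
  proof (intro ball_cong refl)
    fix xs a assume "xs \<in> tup n (universe A)"
    then show "sat A (((!) xs)(n := a)) p \<longleftrightarrow> sat A ((!) (xs @ [a])) p"
      using Suc.prems by (subst sat_nth_snoc) (auto simp: tup_def fm_def)
  qed
  also have "\<dots> \<longleftrightarrow> (\<forall>xs\<in>tup (Suc n) (universe A). sat A ((!) xs) p)"
  proof
    assume L: "\<forall>xs\<in>tup n (universe A). \<forall>a\<in>universe A. sat A ((!) (xs @ [a])) p"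
    show "\<forall>xs\<in>tup (Suc n) (universe A). sat A ((!) xs) p"
    proof
      fix xs assume xs: "xs \<in> tup (Suc n) (universe A)"
      then obtain ys a where "xs = ys @ [a]" by (cases xs rule: rev_cases) (auto simp: tup_def)
      then show "sat A ((!) xs) p" using L xs by (auto simp: tup_def)
    qed
  qed (auto simp: tup_def)
  finally show ?case .
qed

text \<open>The criterion of Ryll-Nardzewski. \<open>inv n\<close> takes finitely many values and
  each of its fibres lies in one orbit, which bounds the number of orbits on
  \<open>n\<close>-tuples; \<open>inv n\<close> may be finer than the orbit partition.\<close>

locale orbit_finite =
  fixes S :: "('f, 'r) signature" and A :: "('f, 'r, 'a) struct" and inv :: "nat \<Rightarrow> 'a list \<Rightarrow> 'c"
  assumes str: "structure_over S A"
    and fin: "finite (inv n ` tup n (universe A))"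
    and orb: "\<lbrakk>xs \<in> tup n (universe A); ys \<in> tup n (universe A); inv n xs = inv n ys\<rbrakk>
      \<Longrightarrow> \<exists>h. automorphism S A h \<and> ys = map h xs"
begin

lemma tp_orbit:
  assumes "xs \<in> tup n (universe A)" "ys \<in> tup n (universe A)" "inv n xs = inv n ys"
  shows "tp S A xs = tp S A ys"
proof -
  obtain h where h: "automorphism S A h" "ys = map h xs" using orb[OF assms] by blast
  obtain u where u: "u \<in> universe A" using str by (auto simp: structure_over_def)
  have len: "length xs = n" "length ys = n" using assms by (auto simp: tup_def)
  have "sat A ((!) xs) p \<longleftrightarrow> sat A ((!) ys) p" if p: "p \<in> fm S n" for p
  proof -
    let ?e = "\<lambda>i. if i < length xs then xs ! i else u"
    have "range ?e \<subseteq> universe A" using assms(1) u by (auto simp: tup_def in_lists_conv_set)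
    then have "sat A (\<lambda>i. h (?e i)) p \<longleftrightarrow> sat A ?e p"
      using sat_automorphism[OF str h(1)] p by (auto simp: fm_def)
    moreover have "sat A (\<lambda>i. h (?e i)) p \<longleftrightarrow> sat A ((!) ys) p"
      by (rule sat_cong) (use p h len in \<open>auto simp: fm_def subset_iff\<close>)
    moreover have "sat A ?e p \<longleftrightarrow> sat A ((!) xs) p"
      by (rule sat_nth_extend) (use p len in \<open>auto simp: fm_def\<close>)
    ultimately show ?thesis by simp
  qed
  then show ?thesis using len by (auto simp: tp_def)
qed

lemma finite_types: "finite (tp S A ` tup n (universe A))"
proof -
  have "tp S A ` tup n (universe A) \<subseteq>
      (\<lambda>c. tp S A (SOME xs. xs \<in> tup n (universe A) \<and> inv n xs = c)) ` inv n ` tup n (universe A)"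
  proof
    fix T assume "T \<in> tp S A ` tup n (universe A)"
    then obtain xs where xs: "xs \<in> tup n (universe A)" "T = tp S A xs" by blast
    let ?ys = "SOME ys. ys \<in> tup n (universe A) \<and> inv n ys = inv n xs"
    have "?ys \<in> tup n (universe A) \<and> inv n ?ys = inv n xs"
      by (rule someI[of _ xs]) (use xs in auto)
    then have "T = tp S A ?ys" using tp_orbit[of ?ys n xs] xs by simp
    then show "T \<in> (\<lambda>c. tp S A (SOME xs. xs \<in> tup n (universe A) \<and> inv n xs = c)) ` inv n ` tup n (universe A)"
      using xs by blast
  qed
  then show ?thesis using fin finite_surj by blast
qed

text \<open>Among finitely many types, the conjunction of one formula separating the given type from
  each other type isolates it.\<close>

lemma isolating_formula:
  assumes "xs \<in> tup n (universe A)"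
  shows "\<exists>q\<in>tp S A xs. \<forall>ys\<in>tup n (universe A). q \<in> tp S A ys \<longrightarrow> tp S A ys = tp S A xs"
proof -
  have len: "length xs = n" using assms by (auto simp: tup_def)
  let ?T = "tp S A ` tup n (universe A) - {tp S A xs}"
  \<comment> \<open>Types are complete: an inclusion between two types of \<open>n\<close>-tuples is
    an equality.\<close>
  have "\<exists>p\<in>tp S A xs. p \<notin> U" if UT: "U \<in> ?T" for U
  proof (rule ccontr)
    assume "\<not> ?thesis"
    then have sub: "tp S A xs \<subseteq> U" by blast
    obtain ys where ys: "ys \<in> tup n (universe A)" "U = tp S A ys" using UT by blast
    have "p \<in> tp S A xs" if "p \<in> tp S A ys" for p
    proof (rule ccontr)
      assume "p \<notin> tp S A xs"
      then have "Neg p \<in> tp S A xs" using that ys len by (auto simp: tp_def tup_def fm_def)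
      then show False using sub that ys by (auto simp: tp_def)
    qed
    then show False using sub ys UT by blast
  qed
  then obtain f where f: "\<And>U. U \<in> ?T \<Longrightarrow> f U \<in> tp S A xs \<and> f U \<notin> U" by metis
  obtain ps where ps: "set ps = f ` ?T" using finite_types[of n] finite_list by (metis finite_Diff finite_imageI)
  have "conjs ps \<in> tp S A xs"
    using f fm_conjs[of ps S n] by (auto simp: tp_def ps sat_conjs len)
  moreover have "tp S A ys = tp S A xs" if "ys \<in> tup n (universe A)" "conjs ps \<in> tp S A ys" for ys
  proof (rule ccontr)
    assume "tp S A ys \<noteq> tp S A xs"
    then have U: "tp S A ys \<in> ?T" using that by blast
    then have "sat A ((!) ys) (f (tp S A ys))" using that(2) ps by (auto simp: tp_def sat_conjs)
    moreover have "f (tp S A ys) \<in> fm S n" using f[OF U] len by (auto simp: tp_def)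
    ultimately show False using f[OF U] that(1) by (auto simp: tp_def tup_def)
  qed
  ultimately show ?thesis by blast
qed

text \<open>A statement about all \<open>n\<close>-tuples is a single sentence
  \<open>alls n p\<close> of the theory; this is how the theory is exploited.\<close>

lemma model_alls:
  assumes M: "is_model S (theory_of S A) M" and p: "p \<in> fm S n"
    and A: "\<And>xs. xs \<in> tup n (universe A) \<Longrightarrow> sat A ((!) xs) p" and ys: "ys \<in> tup n (universe M)"
  shows "sat M ((!) ys) p"
proof -
  have "alls n p \<in> theory_of S A"
    using alls_sentence[OF p] A by (auto simp: theory_of_def models_def sat_alls[OF p])
  then have *: "models M (alls n p)" using M by (auto simp: is_model_def)
  obtain u where u: "u \<in> universe M" using M by (auto simp: is_model_def structure_over_def)
  have "sat M (\<lambda>_. u) (alls n p)" using * u by (auto simp: models_def)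
  then show ?thesis using ys by (simp add: sat_alls[OF p])
qed

text \<open>Two universal statements pass to \<open>M\<close>: every tuple satisfies one of finitely
  many isolating formulas, and an isolating formula implies each formula of its type.\<close>

lemma type_realised:
  assumes M: "is_model S (theory_of S A) M" and ms: "ms \<in> tup n (universe M)"
  shows "\<exists>xs\<in>tup n (universe A). tp S A xs = tp S M ms"
proof -
  obtain q where "\<forall>xs\<in>tup n (universe A). q xs \<in> tp S A xs \<and>
      (\<forall>ys\<in>tup n (universe A). q xs \<in> tp S A ys \<longrightarrow> tp S A ys = tp S A xs)"
    using isolating_formula[of _ n] by metis
  then have q: "\<And>xs. xs \<in> tup n (universe A) \<Longrightarrow> q xs \<in> tp S A xs"
      "\<And>xs ys. xs \<in> tup n (universe A) \<Longrightarrow> ys \<in> tup n (universe A) \<Longrightarrow> q xs \<in> tp S A ys \<Longrightarrow> tp S A ys = tp S A xs"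
    by blast+
  obtain XS where XS: "finite XS" "XS \<subseteq> tup n (universe A)" "tp S A ` XS = tp S A ` tup n (universe A)"
    using finite_types[of n] by (metis finite_subset_image subset_refl)
  obtain ps where ps: "set ps = (\<lambda>xs. Neg (q xs)) ` XS" using XS(1) finite_list by (metis finite_imageI)
  have qfm: "q xs \<in> fm S n" if "xs \<in> tup n (universe A)" for xs
    using q(1)[OF that] that by (auto simp: tp_def tup_def)
  \<comment> \<open>A disjunction of isolating formulas that covers all types.\<close>
  have pfm: "Neg (conjs ps) \<in> fm S n"
    by (intro fm_Neg fm_conjs) (use qfm ps XS(2) in \<open>auto intro!: fm_Neg\<close>)
  have "sat M ((!) ms) (Neg (conjs ps))"
  proof (rule model_alls[OF M pfm _ ms])
    fix xs assume xs: "xs \<in> tup n (universe A)"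
    then obtain ys where ys: "ys \<in> XS" "tp S A ys = tp S A xs" using XS(3) by (metis image_iff)
    then have "sat A ((!) xs) (q ys)" using q(1)[of ys] XS by (auto simp: tp_def)
    then show "sat A ((!) xs) (Neg (conjs ps))" using ys by (auto simp: sat_conjs ps)
  qed
  then obtain xs where xs: "xs \<in> XS" "sat M ((!) ms) (q xs)" by (auto simp: sat_conjs ps)
  have xsA: "xs \<in> tup n (universe A)" using xs XS by auto
  have len: "length ms = n" "length xs = n" using ms xsA by (auto simp: tup_def)
  have sub: "p \<in> tp S M ms" if "p \<in> tp S A xs" for p
  proof -
    have p: "p \<in> fm S n" using that len by (auto simp: tp_def)
    have "sat M ((!) ms) (Neg (Conj (q xs) (Neg p)))"
    proof (rule model_alls[OF M _ _ ms])
      show "Neg (Conj (q xs) (Neg p)) \<in> fm S n" using p qfm[OF xsA] by (auto simp: fm_def)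
      fix ys assume ys: "ys \<in> tup n (universe A)"
      show "sat A ((!) ys) (Neg (Conj (q xs) (Neg p)))"
      proof (cases "sat A ((!) ys) (q xs)")
        case True
        then have "q xs \<in> tp S A ys" using ys qfm[OF xsA] by (auto simp: tp_def tup_def)
        then have "tp S A ys = tp S A xs" using q(2)[OF xsA ys] by simp
        then show ?thesis using that by (auto simp: tp_def)
      qed simp
    qed
    then show ?thesis using xs p len by (auto simp: tp_def)
  qed
  have "p \<in> tp S A xs" if "p \<in> tp S M ms" for p
  proof (rule ccontr)
    assume "p \<notin> tp S A xs"
    then have "Neg p \<in> tp S A xs" using that len by (auto simp: tp_def fm_def)
    then show False using sub[of "Neg p"] that by (auto simp: tp_def)
  qed
  then show ?thesis using sub xsA by blast
qed

text \<open>If \<open>q\<close> isolates the type of the longer tuple, then \<open>Exi n q\<close>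
  lies in the common type of the shorter ones, and a witness in \<open>N\<close> yields a tuple
  whose type is isolated by \<open>q\<close>.\<close>

lemma type_extend:
  assumes M: "is_model S (theory_of S A) M" and N: "is_model S (theory_of S A) N"
    and ms: "ms \<in> tup n (universe M)" and ns: "ns \<in> tup n (universe N)"
    and eq: "tp S M ms = tp S N ns" and m: "m \<in> universe M"
  shows "\<exists>k\<in>universe N. tp S M (ms @ [m]) = tp S N (ns @ [k])"
proof -
  have mm: "ms @ [m] \<in> tup (Suc n) (universe M)" using ms m by (auto simp: tup_def)
  have len: "length ms = n" "length ns = n" using ms ns by (auto simp: tup_def)
  obtain xs where xs: "xs \<in> tup (Suc n) (universe A)" "tp S A xs = tp S M (ms @ [m])"
    using type_realised[OF M mm] by blast
  obtain q where q: "q \<in> tp S A xs"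
      "\<And>ys. ys \<in> tup (Suc n) (universe A) \<Longrightarrow> q \<in> tp S A ys \<Longrightarrow> tp S A ys = tp S A xs"
    using isolating_formula[OF xs(1)] by blast
  have qfm: "q \<in> fm S (Suc n)" using q xs by (auto simp: tp_def tup_def)
  then have fv: "fvars q \<subseteq> {..length ms}" "fvars q \<subseteq> {..length ns}"
    using len by (auto simp: fm_def)
  have "q \<in> tp S M (ms @ [m])" using q(1) xs(2) by simp
  then have "sat M ((!) (ms @ [m])) q" by (simp add: tp_def)
  then have "sat M (((!) ms)(n := m)) q" using sat_nth_snoc[OF fv(1)] len by simp
  then have "Exi n q \<in> tp S M ms" using m fm_Exi[OF qfm] len by (auto simp: tp_def)
  then have "Exi n q \<in> tp S N ns" using eq by simp
  then obtain k where k: "k \<in> universe N" "sat N (((!) ns)(n := k)) q" by (auto simp: tp_def)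
  then have "sat N ((!) (ns @ [k])) q" using sat_nth_snoc[OF fv(2)] len by simp
  then have qk: "q \<in> tp S N (ns @ [k])" using qfm len by (auto simp: tp_def)
  obtain ys where ys: "ys \<in> tup (Suc n) (universe A)" "tp S A ys = tp S N (ns @ [k])"
    using type_realised[OF N, of "ns @ [k]" "Suc n"] ns k by (auto simp: tup_def)
  then have "tp S A ys = tp S A xs" using q(2) qk by simp
  then show ?thesis using k xs ys by auto
qed

lemma isomorphic_models:
  fixes M :: "('f, 'r, 'm) struct" and N :: "('f, 'r, 'n) struct"
  assumes M: "is_model S (theory_of S A) M" and N: "is_model S (theory_of S A) N"
    and cM: "countable (universe M)" and cN: "countable (universe N)"
  shows "isomorphic_structs S M N"
proof -
  let ?P = "\<lambda>l. tp S M (map fst l) = tp S N (map snd l)"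
  have str: "structure_over S M" "structure_over S N" using M N by (auto simp: is_model_def)
  have tupI: "map fst l \<in> tup (length l) (universe M)" "map snd l \<in> tup (length l) (universe N)"
    if "set l \<subseteq> universe M \<times> universe N" for l
    using that by (auto simp: tup_def in_lists_conv_set)
  obtain R where R: "R \<subseteq> universe M \<times> universe N" "set [] \<subseteq> R" "fst ` R = universe M"
      "snd ` R = universe N"
      "\<And>F. finite F \<Longrightarrow> F \<subseteq> R \<Longrightarrow> \<exists>l. ?P l \<and> F \<subseteq> set l \<and> set l \<subseteq> R"
  proof (rule back_and_forth[of "universe M" "universe N" ?P "[]"])
    obtain xs where "xs \<in> tup 0 (universe A)" "tp S A xs = tp S M []"
      using type_realised[OF M, of "[]" 0] by (auto simp: tup_def)
    moreover obtain ys where "ys \<in> tup 0 (universe A)" "tp S A ys = tp S N []"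
      using type_realised[OF N, of "[]" 0] by (auto simp: tup_def)
    ultimately show "?P []" by (auto simp: tup_def)
    fix l :: "('m \<times> 'n) list"
    assume l: "?P l" "set l \<subseteq> universe M \<times> universe N"
    show "\<exists>y\<in>universe N. ?P (l @ [(x, y)])" if "x \<in> universe M" for x
      using type_extend[OF M N tupI[OF l(2)] l(1) that] by simp
    show "\<exists>x\<in>universe M. ?P (l @ [(x, y)])" if "y \<in> universe N" for y
      using type_extend[OF N M tupI(2)[OF l(2)] tupI(1)[OF l(2)] l(1)[symmetric] that]
      by (auto dest: sym)
  qed (use cM cN str in \<open>auto simp: structure_over_def\<close>)
  \<comment> \<open>Addressing pairs of \<open>R\<close> by positions \<open>js\<close> in one list
    turns every atomic statement about them into a formula with variables \<open>js\<close>, on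
    which both sides agree.\<close>
  have idx: "\<exists>l js. ?P l \<and> zs = map ((!) l) js \<and> set js \<subseteq> {..<length l}" if zsR: "set zs \<subseteq> R" for zs
  proof -
    obtain l where l: "?P l" "set zs \<subseteq> set l" using R(5)[OF _ zsR] by auto
    then have "\<forall>z\<in>set zs. \<exists>j<length l. l ! j = z" by (auto simp: in_set_conv_nth subset_iff)
    then obtain j where j: "\<And>z. z \<in> set zs \<Longrightarrow> j z < length l \<and> l ! (j z) = z" by metis
    have "zs = map ((!) l) (map j zs)" using j by (auto intro!: map_idI[symmetric])
    then show ?thesis using l(1) j by (intro exI[of _ l] exI[of _ "map j zs"]) auto
  qed
  have transfer: "sat M ((!) (map fst l)) p \<longleftrightarrow> sat N ((!) (map snd l)) p" if "?P l" "p \<in> fm S (length l)" for l p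
    using that by (auto simp: tp_def)
  have eqv: "x = x' \<longleftrightarrow> y = y'" if xy: "(x, y) \<in> R" "(x', y') \<in> R" for x y x' y'
  proof -
    have "set [(x, y), (x', y')] \<subseteq> R" using xy by simp
    from idx[OF this] obtain l js where l: "?P l" "[(x, y), (x', y')] = map ((!) l) js"
      "set js \<subseteq> {..<length l}" by (elim exE conjE)
    from l(2) obtain i j where ij: "js = [i, j]" "l ! i = (x, y)" "l ! j = (x', y')"
      by (cases js; cases "tl js") auto
    have "i < length l" "j < length l" using l(3) ij(1) by auto
    note ij = ij this
    have "Eq (Var i) (Var j) \<in> fm S (length l)" using ij by (auto simp: fm_def)
    from transfer[OF l(1) this] show ?thesis using ij by simp
  qed
  have rel: "map fst zs \<in> rint M r \<longleftrightarrow> map snd zs \<in> rint N r"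
    if zs: "set zs \<subseteq> R" "r \<in> rsyms S" "length zs = rarity S r" for r zs
  proof -
    obtain l js where l: "?P l" "zs = map ((!) l) js" "set js \<subseteq> {..<length l}"
      using idx[OF zs(1)] by auto
    have "Rel r (map Var js) \<in> fm S (length l)"
      using l zs by (auto simp: fm_def list_all_iff)
    note transfer[OF l(1) this]
    moreover have "map ((!) (map fst l)) js = map fst zs" "map ((!) (map snd l)) js = map snd zs"
      using l by auto
    ultimately show ?thesis by (simp add: o_def)
  qed
  have func: "fint M g (map fst zs) = x \<longleftrightarrow> fint N g (map snd zs) = y"
    if zs: "set zs \<subseteq> R" "g \<in> fsyms S" "length zs = farity S g" "(x, y) \<in> R" for g zs x y
  proof -
    have "set ((x, y) # zs) \<subseteq> R" using zs by simp
    from idx[OF this] obtain l js' where l: "?P l" "(x, y) # zs = map ((!) l) js'"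
      "set js' \<subseteq> {..<length l}" by (elim exE conjE)
    from l(2) obtain i js where js: "js' = i # js" "l ! i = (x, y)" "zs = map ((!) l) js"
      by (cases js') auto
    have "Eq (App g (map Var js)) (Var i) \<in> fm S (length l)"
      using l js zs by (auto simp: fm_def list_all_iff)
    note transfer[OF l(1) this]
    moreover have "map ((!) (map fst l)) js = map fst zs" "map ((!) (map snd l)) js = map snd zs"
      using l js by auto
    moreover have "i < length l" using l(3) js(1) by simp
    ultimately show ?thesis using js(2) by (simp add: o_def)
  qed
  define h where "h = (\<lambda>x\<in>universe M. SOME y. (x, y) \<in> R)"
  have hR: "(x, h x) \<in> R" if x: "x \<in> universe M" for x
  proof -
    obtain y where "(x, y) \<in> R" using x R(3) by force
    then show ?thesis using x by (auto simp: h_def intro: someI)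
  qed
  have hz: "set (map (\<lambda>x. (x, h x)) xs) \<subseteq> R" if "xs \<in> lists (universe M)" for xs
    using that hR by auto
  have relh: "xs \<in> rint M r \<longleftrightarrow> map h xs \<in> rint N r"
    if "xs \<in> lists (universe M)" "r \<in> rsyms S" "length xs = rarity S r" for xs r
    using rel[OF hz[OF that(1)] that(2)] that(3) by (simp add: o_def)
  have hU: "h \<in> universe M \<rightarrow>\<^sub>E universe N" using hR R(1) by (auto simp: h_def)
  have "h (fint M g xs) = fint N g (map h xs)"
    if xs: "xs \<in> lists (universe M)" and g: "g \<in> fsyms S" "length xs = farity S g" for g xs
  proof -
    have "fint M g xs \<in> universe M" using str(1) xs g by (auto simp: structure_over_def)
    from func[OF hz[OF xs] g(1) _ hR[OF this]] show ?thesis using g(2) by (simp add: o_def)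
  qed
  then have "h \<in> homs S M N"
    using hU relh str(1) by (fastforce simp: homs_def structure_over_def)
  moreover have "bij_betw h (universe M) (universe N)"
  proof (rule bij_betw_imageI)
    show "inj_on h (universe M)" by (rule inj_onI) (metis hR eqv)
    show "h ` universe M = universe N"
    proof
      show "universe N \<subseteq> h ` universe M"
      proof
        fix y assume "y \<in> universe N"
        then obtain x where x: "(x, y) \<in> R" using R(4) by force
        then have "x \<in> universe M" using R(1) by auto
        then have "h x = y" using eqv[OF x hR[of x]] by simp
        then show "y \<in> h ` universe M" using \<open>x \<in> universe M\<close> by blast
      qed
    qed (use hU in auto)
  qed
  ultimately show ?thesis using relh by (auto simp: isomorphic_structs_def)
qed

lemma omega_categorical: "omega_categorical S A"
  unfolding omega_categorical_def using isomorphic_models by auto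

end

section \<open>Essentially unary polymorphism clones\<close>

definition unary_clone :: "('a \<Rightarrow> 'a) set \<Rightarrow> 'a operation set" where
  "unary_clone E = {(k, \<lambda>x\<in>tuples k UNIV. e (x i)) | k i e. i < k \<and> e \<in> E}"

definition unary_op :: "('a \<Rightarrow> 'a) \<Rightarrow> 'a operation" where
  "unary_op e = (1, \<lambda>x\<in>tuples 1 UNIV. e (x 0))"

text \<open>Relation 0 is preserved only by essentially unary operations, and relation \<open>n + 1\<close> is the
  \<open>E\<close>-orbit of the tuple coded by \<open>n\<close>. Hence the polymorphisms of the following structure are the
  operations depending on one coordinate through an element of the closure of \<open>E\<close>.\<close>

definition orbit_signature :: "(nat, nat) signature" where
  "orbit_signature = \<lparr>fsyms = {}, farity = (\<lambda>_. 0), rsyms = UNIV,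
     rarity = (\<lambda>r. case r of 0 \<Rightarrow> 4 | Suc n \<Rightarrow> length (from_nat n :: nat list))\<rparr>"

definition orbit_structure :: "(nat \<Rightarrow> nat) set \<Rightarrow> (nat, nat, nat) struct" where
  "orbit_structure E = \<lparr>universe = UNIV, fint = (\<lambda>_ _. 0),
     rint = (\<lambda>r. case r of 0 \<Rightarrow> {[a, b, c, d] | a b c d. a = b \<or> c = d}
       | Suc n \<Rightarrow> {map e (from_nat n) | e. e \<in> E})\<rparr>"

lemma orbit_structure_simps [simp]:
  "universe (orbit_structure E) = UNIV" "fsyms orbit_signature = {}" "rsyms orbit_signature = UNIV"
  "rarity orbit_signature 0 = 4" "rarity orbit_signature (Suc n) = length (from_nat n :: nat list)"
  "rint (orbit_structure E) 0 = {[a, b, c, d] | a b c d. a = b \<or> c = d}"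
  "rint (orbit_structure E) (Suc n) = {map e (from_nat n) | e. e \<in> E}"
  by (simp_all add: orbit_structure_def orbit_signature_def)

lemma countable_orbit_structure: "countable_structure orbit_signature (orbit_structure E)"
proof -
  have "rint (orbit_structure E) r \<subseteq> {xs. length xs = rarity orbit_signature r}" for r
    by (cases r) auto
  then show ?thesis by (auto simp: countable_structure_def structure_over_def)
qed

lemma tuples_UNIV: "x \<in> tuples k UNIV \<longleftrightarrow> x \<in> extensional {..<k}"
  by (auto simp: tuples_def PiE_def)

section \<open>Polymorphisms of the orbit structure of a closed monoid\<close>

locale closed_monoid =
  fixes E :: "(nat \<Rightarrow> nat) set"
  assumes id_mem: "id \<in> E"
    and comp_mem: "e \<in> E \<Longrightarrow> e' \<in> E \<Longrightarrow> e \<circ> e' \<in> E"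
    and inj_mem: "e \<in> E \<Longrightarrow> inj e"
    and closed: "(\<And>F. finite F \<Longrightarrow> \<exists>e'\<in>E. \<forall>x\<in>F. e' x = e x) \<Longrightarrow> e \<in> E"
begin

abbreviation "S \<equiv> orbit_signature"
abbreviation "A \<equiv> orbit_structure E"

lemma rint_closed: "xs \<in> rint A r \<Longrightarrow> e \<in> E \<Longrightarrow> map e xs \<in> rint A r"
proof (cases r)
  case (Suc n)
  assume "xs \<in> rint A r" "e \<in> E"
  then obtain e' where "e' \<in> E" "xs = map e' (from_nat n)" using Suc by auto
  then have "map e xs = map (e \<circ> e') (from_nat n)" "e \<circ> e' \<in> E" using comp_mem \<open>e \<in> E\<close> by auto
  then show ?thesis using Suc by (simp only: orbit_structure_simps) blast
qed auto

lemma unary_clone_subset_Pol: "unary_clone E \<subseteq> Pol S A"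
proof
  fix F assume "F \<in> unary_clone E"
  then obtain k i e where F: "F = (k, \<lambda>x\<in>tuples k UNIV. e (x i))" "i < k" "e \<in> E"
    by (auto simp: unary_clone_def)
  have "map (\<lambda>x\<in>tuples k UNIV. e (x i)) xs \<in> rint A r"
    if "xs \<in> rint (power_struct k A) r" for r xs
  proof -
    have xs: "xs \<in> lists (tuples k UNIV)" "map (\<lambda>t. t i) xs \<in> rint A r"
      using that F(2) by (auto simp: power_struct_def)
    have "map (\<lambda>x\<in>tuples k UNIV. e (x i)) xs = map e (map (\<lambda>t. t i) xs)"
      using xs(1) by auto
    then show ?thesis using rint_closed[OF xs(2) F(3)] by (simp only:)
  qed
  then have "(\<lambda>x\<in>tuples k UNIV. e (x i)) \<in> homs S (power_struct k A) A"
    by (auto simp: homs_def power_struct_def)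
  then show "F \<in> Pol S A" using F by (auto simp: Pol_def)
qed

text \<open>Relation 0 forbids two distinct coordinates on which \<open>f\<close> depends. The orbit
  relations force the restriction of \<open>f\<close> to constant tuples to agree on each finite set
  with a member of \<open>E\<close>, and \<open>closed\<close> puts it into
  \<open>E\<close>.\<close>

lemma Pol_subset_unary_clone: "Pol S A \<subseteq> unary_clone E"
proof
  fix F assume "F \<in> Pol S A"
  then obtain k f where F: "F = (k, f)" "1 \<le> k" and f: "f \<in> homs S (power_struct k A) A"
    by (auto simp: Pol_def)
  have ext: "f \<in> extensional (tuples k UNIV)"
    using f by (simp add: homs_def power_struct_def PiE_def)
  have pres: "map f xs \<in> rint A r"
    if "xs \<in> lists (tuples k UNIV)" "\<And>i. i < k \<Longrightarrow> map (\<lambda>t. t i) xs \<in> rint A r" for xs r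
    using f that by (auto simp: homs_def power_struct_def)
  define dep where "dep i \<longleftrightarrow> (\<exists>x\<in>tuples k UNIV. \<exists>y\<in>tuples k UNIV.
      (\<forall>j. j \<noteq> i \<longrightarrow> x j = y j) \<and> f x \<noteq> f y)" for i
  have uniq: "i = j" if "dep i" "dep j" for i j
  proof (rule ccontr)
    assume "i \<noteq> j"
    obtain x y where x: "x \<in> tuples k UNIV" "y \<in> tuples k UNIV" "\<And>l. l \<noteq> i \<Longrightarrow> x l = y l" "f x \<noteq> f y"
      using \<open>dep i\<close> by (auto simp: dep_def)
    obtain u v where u: "u \<in> tuples k UNIV" "v \<in> tuples k UNIV" "\<And>l. l \<noteq> j \<Longrightarrow> u l = v l" "f u \<noteq> f v"
      using \<open>dep j\<close> by (auto simp: dep_def)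
    \<comment> \<open>As \<open>i\<close> and \<open>j\<close> differ, at each coordinate
      \<open>x\<close> agrees with \<open>y\<close> or \<open>u\<close> agrees with
      \<open>v\<close>. The values of \<open>f\<close> must then satisfy the same
      disjunction.\<close>
    have "map f [x, y, u, v] \<in> rint A 0"
    proof (rule pres)
      fix l assume "l < k"
      have "x l = y l \<or> u l = v l" using x(3)[of l] u(3)[of l] \<open>i \<noteq> j\<close> by auto
      then show "map (\<lambda>t. t l) [x, y, u, v] \<in> rint A 0" by simp
    qed (use x u in auto)
    then show False using x u by simp
  qed
  \<comment> \<open>If \<open>f\<close> depends on no coordinate, 0 serves; it exists because
    \<open>1 \<le> k\<close>.\<close>
  obtain i where i: "i < k" "\<And>j. j < k \<Longrightarrow> dep j \<Longrightarrow> j = i"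
  proof (cases "\<exists>i<k. dep i")
    case True
    then show ?thesis using that uniq by blast
  next
    case False
    then show ?thesis using that[of 0] F(2) by auto
  qed
  have dep_only: "f x = f y" if xy: "x \<in> tuples k UNIV" "y \<in> tuples k UNIV" "x i = y i" for x y
  proof -
    \<comment> \<open>Replaces the coordinates of \<open>x\<close> by those of \<open>y\<close> one
      at a time; only coordinate \<open>i\<close> could matter, and there they agree.\<close>
    define z where "z n = (\<lambda>j. if j < n then y j else x j)" for n
    have zt: "z n \<in> tuples k UNIV" if "n \<le> k" for n
      using that xy by (auto simp: z_def tuples_UNIV extensional_def)
    have "f (z n) = f x" if "n \<le> k" for n
      using that
    proof (induction n)
      case 0
      then show ?case by (simp add: z_def)
    next
      case (Suc n)
      have "f (z (Suc n)) = f (z n)"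
      proof (cases "n = i")
        case True
        then have "z (Suc n) = z n" using xy(3) by (auto simp: z_def fun_eq_iff less_Suc_eq)
        then show ?thesis by simp
      next
        case False
        then have "\<not> dep n" using i(2) Suc.prems by auto
        moreover have "\<forall>j. j \<noteq> n \<longrightarrow> z (Suc n) j = z n j" by (auto simp: z_def)
        ultimately show ?thesis using zt Suc.prems unfolding dep_def by (meson Suc_leD)
      qed
      then show ?case using Suc by simp
    qed
    moreover have "z k = y" using xy by (auto simp: z_def fun_eq_iff tuples_UNIV extensional_def)
    ultimately show ?thesis by (metis order_refl)
  qed
  define con where "con a = (\<lambda>j\<in>{..<k}. a)" for a :: nat
  have con: "con a \<in> tuples k UNIV" for a by (auto simp: con_def tuples_UNIV)
  have "(\<lambda>a. f (con a)) \<in> E"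
  proof (rule closed)
    fix G :: "nat set" assume "finite G"
    then obtain xs where xs: "set xs = G" using finite_list by blast
    \<comment> \<open>Relation \<open>Suc (to_nat xs)\<close> is the orbit of \<open>xs\<close>;
      each coordinate of \<open>map con xs\<close> is \<open>xs\<close> itself, which is in the
      orbit by the identity.\<close>
    have "map f (map con xs) \<in> rint A (Suc (to_nat xs))"
    proof (rule pres)
      fix j assume "j < k"
      then have "map (\<lambda>t. t j) (map con xs) = map id xs"
        unfolding map_map by (intro map_cong refl) (simp add: con_def)
      then show "map (\<lambda>t. t j) (map con xs) \<in> rint A (Suc (to_nat xs))"
        using id_mem by (simp only: orbit_structure_simps from_nat_to_nat) blast
    qed (use con in auto)
    then obtain e where "e \<in> E" "map f (map con xs) = map e xs" by auto
    then show "\<exists>e\<in>E. \<forall>x\<in>G. e x = f (con x)" using xs by auto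
  qed
  moreover have "f = (\<lambda>x\<in>tuples k UNIV. f (con (x i)))"
    by (rule extensionalityI[OF ext]) (use i(1) con in \<open>auto intro!: dep_only simp: con_def\<close>)
  ultimately show "F \<in> unary_clone E"
    using F(1) i(1) unfolding unary_clone_def mem_Collect_eq
    by (intro exI[of _ k] exI[of _ i] exI[of _ "\<lambda>a. f (con a)"]) simp
qed

lemma Pol_eq: "Pol S A = unary_clone E"
  using unary_clone_subset_Pol Pol_subset_unary_clone by blast

lemma automorphismI:
  assumes "bij h" "h \<in> E" "inv h \<in> E"
  shows "automorphism S A h"
proof -
  have "map h xs \<in> rint A r \<Longrightarrow> xs \<in> rint A r" for xs r
    using rint_closed[of "map h xs" r "inv h"] assms by (simp add: bij_is_inj)
  moreover have "map h xs \<in> rint A r" if "xs \<in> rint A r" for xs r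
    using rint_closed that assms by blast
  ultimately show ?thesis
    using assms(1) unfolding automorphism_def homs_def by simp
qed

end

section \<open>Isomorphisms and topology of essentially unary clones\<close>

lemma unary_op_mem: "e \<in> E \<Longrightarrow> unary_op e \<in> unary_clone E"
  by (auto simp: unary_clone_def unary_op_def)

lemma unary_op_exhaust:
  assumes "F \<in> unary_clone E" "fst F = 1"
  obtains e where "e \<in> E" "F = unary_op e"
  using assms by (auto simp: unary_clone_def unary_op_def)

lemma unary_op_apply: "snd (unary_op e) (\<lambda>i\<in>{..<1}. a) = e a"
  by (auto simp: unary_op_def tuples_UNIV)

lemma unary_op_inject [simp]: "unary_op e = unary_op e' \<longleftrightarrow> e = e'"
  by (metis ext unary_op_apply)

lemma compose_unary_op: "compose_op UNIV 1 (unary_op e) (\<lambda>_. unary_op e') = unary_op (e \<circ> e')"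
  by (auto simp: compose_op_def unary_op_def tuples_UNIV fun_eq_iff)

text \<open>Constant tuples give \<open>e = e'\<close>. If the coordinates differed, a tuple with
  entries 1 and 0 there would give \<open>e 1 = e 0\<close>, against injectivity.\<close>

lemma essentially_unary_eq:
  fixes e e' :: "nat \<Rightarrow> nat"
  assumes "i < k" "i' < k" "inj e"
    and eq: "(\<lambda>x\<in>tuples k UNIV. e (x i)) = (\<lambda>x\<in>tuples k UNIV. e' (x i'))"
  shows "i = i' \<and> e = e'"
proof -
  have *: "e (x i) = e' (x i')" if "x \<in> tuples k UNIV" for x
    using fun_cong[OF eq, of x] that by simp
  have ee: "e a = e' a" for a
    using *[of "\<lambda>j\<in>{..<k}. a"] assms by (auto simp: tuples_UNIV)
  have "i = i'"
  proof (rule ccontr)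
    assume "i \<noteq> i'"
    then have "e 1 = e' 0"
      using *[of "\<lambda>j\<in>{..<k}. if j = i then 1 else 0"] assms by (auto simp: tuples_UNIV)
    then show False using ee[of 0] injD[OF assms(3), of 1 0] by simp
  qed
  then show ?thesis using ee by auto
qed

text \<open>Arity, coordinate and injective unary map are determined by the operation, and a
  composition takes its coordinate from the inner operation selected by the outer one. So applying
  \<open>\<psi>\<close> to the unary map alone is compatible with composition.\<close>

lemma clone_iso_unary_clone:
  fixes E E' :: "(nat \<Rightarrow> nat) set"
  assumes bij: "bij_betw \<psi> E E'" and hom: "\<And>e f. e \<in> E \<Longrightarrow> f \<in> E \<Longrightarrow> \<psi> (e \<circ> f) = \<psi> e \<circ> \<psi> f"
    and comp: "\<And>e f. e \<in> E \<Longrightarrow> f \<in> E \<Longrightarrow> e \<circ> f \<in> E"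
    and inj: "\<And>e. e \<in> E \<Longrightarrow> inj e" "\<And>e. e \<in> E' \<Longrightarrow> inj e"
  shows "\<exists>\<xi>. clone_iso UNIV (unary_clone E) UNIV (unary_clone E') \<xi>"
proof -
  define op where "op k i e = (k, \<lambda>x\<in>tuples k UNIV. e (x i))" for k i and e :: "nat \<Rightarrow> nat"
  have mem: "F \<in> unary_clone D \<longleftrightarrow> (\<exists>k i e. F = op k i e \<and> i < k \<and> e \<in> D)" for F D
    by (auto simp: unary_clone_def op_def)
  have op_eq: "op k i e = op k' i' e' \<longleftrightarrow> k = k' \<and> i = i' \<and> e = e'"
    if "i < k" "i' < k'" "inj e" for k i e k' i' e'
    using essentially_unary_eq[of i k i' e e'] that by (auto simp: op_def)
  \<comment> \<open>Well defined by \<open>op_eq\<close>, since members of \<open>E\<close> are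
    injective.\<close>
  define \<xi> where "\<xi> F = (THE G. \<exists>k i e. F = op k i e \<and> i < k \<and> e \<in> E \<and> G = op k i (\<psi> e))" for F
  have \<xi>: "\<xi> (op k i e) = op k i (\<psi> e)" if "i < k" "e \<in> E" for k i e
    unfolding \<xi>_def
  proof (rule the_equality)
    show "\<exists>k' i' e'. op k i e = op k' i' e' \<and> i' < k' \<and> e' \<in> E \<and> op k i (\<psi> e) = op k' i' (\<psi> e')"
      using that by blast
    fix G assume "\<exists>k' i' e'. op k i e = op k' i' e' \<and> i' < k' \<and> e' \<in> E \<and> G = op k' i' (\<psi> e')"
    then show "G = op k i (\<psi> e)" using that inj op_eq by metis
  qed
  have \<psi>E: "\<psi> e \<in> E'" if "e \<in> E" for e using bij that by (auto simp: bij_betw_def)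
  have compose: "compose_op UNIV m (op n i e) (\<lambda>l. op m (s l) (d l)) = op m (s i) (e \<circ> d i)"
    if "i < n" for m n i e s d
    using that by (auto simp: compose_op_def op_def tuples_UNIV fun_eq_iff)
  have compose_cong: "compose_op UNIV m (op n i e) G = compose_op UNIV m (op n i e) H"
    if "\<And>l. l < n \<Longrightarrow> G l = H l" for m n i e G H
  proof -
    have "(\<lambda>l\<in>{..<n}. snd (G l) x) = (\<lambda>l\<in>{..<n}. snd (H l) x)" for x
      using that by (auto simp: restrict_def)
    then show ?thesis by (simp add: compose_op_def op_def)
  qed
  have "clone_hom UNIV (unary_clone E) UNIV (unary_clone E') \<xi>"
    unfolding clone_hom_def
  proof (intro conjI ballI allI impI)
    show "\<xi> \<in> unary_clone E \<rightarrow> unary_clone E'"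
      using \<xi> \<psi>E by (fastforce simp: mem)
    show "fst (\<xi> F) = fst F" if "F \<in> unary_clone E" for F
      using that \<xi> by (auto simp: mem op_def)
    fix m F G
    assume F: "F \<in> unary_clone E" and G: "\<forall>i<fst F. G i \<in> unary_clone E \<and> fst (G i) = m"
    obtain n i e where n: "F = op n i e" "i < n" "e \<in> E" using F by (auto simp: mem)
    have "\<exists>s d. G l = op m s d \<and> s < m \<and> d \<in> E" if "l < n" for l
    proof -
      have "G l \<in> unary_clone E" "fst (G l) = m" using G that n(1) by (auto simp: op_def)
      then obtain i' e' where "G l = op m i' e'" "i' < m" "e' \<in> E" unfolding mem by (auto simp: op_def)
      then show ?thesis by blast
    qed
    then obtain s d where sd: "\<And>l. l < n \<Longrightarrow> G l = op m (s l) (d l) \<and> s l < m \<and> d l \<in> E"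
      by metis
    have "compose_op UNIV m F G = op m (s i) (e \<circ> d i)"
      using compose_cong[of n G "\<lambda>l. op m (s l) (d l)"] sd n compose by simp
    then have "\<xi> (compose_op UNIV m F G) = op m (s i) (\<psi> e \<circ> \<psi> (d i))"
      using sd[OF n(2)] n \<xi> hom comp by simp
    moreover have "compose_op UNIV m (\<xi> F) (\<lambda>i. \<xi> (G i)) = op m (s i) (\<psi> e \<circ> \<psi> (d i))"
      using compose_cong[of n "\<lambda>i. \<xi> (G i)" "\<lambda>l. op m (s l) (\<psi> (d l))"] sd n compose \<xi> by simp
    ultimately show "\<xi> (compose_op UNIV m F G) = compose_op UNIV m (\<xi> F) (\<lambda>i. \<xi> (G i))"
      by simp
  qed
  moreover have "bij_betw \<xi> (unary_clone E) (unary_clone E')"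
  proof (rule bij_betw_imageI)
    show "inj_on \<xi> (unary_clone E)"
    proof (rule inj_onI)
      fix F G assume "F \<in> unary_clone E" "G \<in> unary_clone E" "\<xi> F = \<xi> G"
      then obtain k i e k' i' e' where *: "F = op k i e" "i < k" "e \<in> E" "G = op k' i' e'" "i' < k'" "e' \<in> E"
          "op k i (\<psi> e) = op k' i' (\<psi> e')"
        using \<xi> by (auto simp: mem)
      then have "k = k' \<and> i = i' \<and> \<psi> e = \<psi> e'" using op_eq inj(2)[OF \<psi>E[OF *(3)]] by blast
      then show "F = G" using * bij by (auto simp: bij_betw_def inj_on_eq_iff)
    qed
    show "\<xi> ` unary_clone E = unary_clone E'"
    proof
      show "unary_clone E' \<subseteq> \<xi> ` unary_clone E"
      proof
        fix F assume "F \<in> unary_clone E'"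
        then obtain k i e' where "F = op k i e'" "i < k" "e' \<in> E'" by (auto simp: mem)
        moreover then obtain e where "e \<in> E" "e' = \<psi> e" using bij by (auto simp: bij_betw_def)
        ultimately show "F \<in> \<xi> ` unary_clone E" using \<xi> mem by (metis image_eqI)
      qed
    qed (use \<xi> \<psi>E in \<open>fastforce simp: mem\<close>)
  qed
  ultimately show ?thesis by (auto simp: clone_iso_def)
qed

text \<open>Restriction to arity 1 reduces an isomorphism of clones to one of monoids, where the
  topological obstruction is found.\<close>

lemma clone_iso_unary:
  assumes iso: "clone_iso UNIV (unary_clone E) UNIV (unary_clone E') \<xi>"
  obtains \<psi> where "bij_betw \<psi> E E'" "\<And>e. e \<in> E \<Longrightarrow> \<xi> (unary_op e) = unary_op (\<psi> e)"
    "\<And>e f. e \<in> E \<Longrightarrow> f \<in> E \<Longrightarrow> e \<circ> f \<in> E \<Longrightarrow> \<psi> (e \<circ> f) = \<psi> e \<circ> \<psi> f"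
proof -
  have hom: "clone_hom UNIV (unary_clone E) UNIV (unary_clone E') \<xi>"
    and bij: "bij_betw \<xi> (unary_clone E) (unary_clone E')" using iso by (auto simp: clone_iso_def)
  have "\<exists>e'\<in>E'. \<xi> (unary_op e) = unary_op e'" if e: "e \<in> E" for e
  proof -
    have "\<xi> (unary_op e) \<in> unary_clone E'" "fst (\<xi> (unary_op e)) = 1"
      using hom unary_op_mem[OF e] by (auto simp: clone_hom_def unary_op_def)
    then show ?thesis using unary_op_exhaust by metis
  qed
  then obtain \<psi> where \<psi>: "\<And>e. e \<in> E \<Longrightarrow> \<psi> e \<in> E'" "\<And>e. e \<in> E \<Longrightarrow> \<xi> (unary_op e) = unary_op (\<psi> e)"
    by metis
  show ?thesis
  proof
    show "bij_betw \<psi> E E'"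
    proof (rule bij_betw_imageI)
      show "inj_on \<psi> E"
      proof (rule inj_onI)
        fix e f assume *: "e \<in> E" "f \<in> E" "\<psi> e = \<psi> f"
        then have "\<xi> (unary_op e) = \<xi> (unary_op f)" using \<psi> by simp
        then have "unary_op e = unary_op f"
          using bij inj_onD unary_op_mem[OF *(1)] unary_op_mem[OF *(2)] by (fastforce simp: bij_betw_def)
        then show "e = f" by simp
      qed
      show "\<psi> ` E = E'"
      proof
        show "E' \<subseteq> \<psi> ` E"
        proof
          fix e' assume "e' \<in> E'"
          then have "unary_op e' \<in> \<xi> ` unary_clone E" using bij unary_op_mem by (auto simp: bij_betw_def)
          then obtain F where F: "F \<in> unary_clone E" "\<xi> F = unary_op e'" by force
          then have "fst F = 1" using hom by (auto simp: clone_hom_def unary_op_def)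
          then obtain e where "e \<in> E" "F = unary_op e" using F unary_op_exhaust by metis
          then show "e' \<in> \<psi> ` E" using F \<psi> by auto
        qed
      qed (use \<psi> in auto)
    qed
    show "\<xi> (unary_op e) = unary_op (\<psi> e)" if "e \<in> E" for e using \<psi> that by blast
    fix e f assume ef: "e \<in> E" "f \<in> E" "e \<circ> f \<in> E"
    have "\<forall>i<fst (unary_op e). unary_op f \<in> unary_clone E \<and> fst (unary_op f) = 1"
      using ef unary_op_mem by (auto simp: unary_op_def)
    moreover have "\<forall>m. \<forall>F\<in>unary_clone E. \<forall>G. (\<forall>i<fst F. G i \<in> unary_clone E \<and> fst (G i) = m) \<longrightarrow>
        \<xi> (compose_op UNIV m F G) = compose_op UNIV m (\<xi> F) (\<lambda>i. \<xi> (G i))"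
      using hom by (simp add: clone_hom_def)
    ultimately have "\<xi> (compose_op UNIV 1 (unary_op e) (\<lambda>_. unary_op f)) =
        compose_op UNIV 1 (\<xi> (unary_op e)) (\<lambda>_. \<xi> (unary_op f))"
      using unary_op_mem[OF ef(1)] by simp
    then have "\<xi> (unary_op (e \<circ> f)) = compose_op UNIV 1 (unary_op (\<psi> e)) (\<lambda>_. unary_op (\<psi> f))"
      by (simp only: compose_unary_op \<psi>(2) ef)
    then have "unary_op (\<psi> (e \<circ> f)) = unary_op (\<psi> e \<circ> \<psi> f)"
      by (simp only: compose_unary_op \<psi>(2) ef)
    then show "\<psi> (e \<circ> f) = \<psi> e \<circ> \<psi> f" by simp
  qed
qed

text \<open>Convergence in a product of discrete spaces is eventual constancy at each point, and the
  injection of the summand of arity 1 is continuous.\<close>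

lemma limitin_unary_op:
  assumes mem: "\<And>n. s n \<in> E" "e \<in> E" and lim: "\<And>x. \<forall>\<^sub>F n in sequentially. s n x = e x"
  shows "limitin (clone_topology UNIV (unary_clone E)) (\<lambda>n. unary_op (s n)) (unary_op e) sequentially"
proof -
  let ?T = "product_topology (\<lambda>_. discrete_topology UNIV) (tuples 1 UNIV) :: ((nat \<Rightarrow> 'a) \<Rightarrow> 'a) topology"
  let ?f = "\<lambda>e. \<lambda>x\<in>tuples 1 UNIV. e (x (0::nat))"
  have "limitin ?T (\<lambda>n. ?f (s n)) (?f e) sequentially"
  proof (subst limitin_componentwise, intro conjI ballI)
    fix x :: "nat \<Rightarrow> 'a" assume "x \<in> tuples 1 UNIV"
    then show "limitin (discrete_topology UNIV) (\<lambda>n. ?f (s n) x) (?f e x) sequentially"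
      using lim[of "x 0"] by (auto simp: limitin_def elim: eventually_mono)
  qed auto
  moreover have "continuous_map ?T (operations_topology UNIV) (Pair 1)"
    unfolding operations_topology_def by (rule continuous_map_component_injection) auto
  ultimately have "limitin (operations_topology UNIV) (Pair 1 \<circ> (\<lambda>n. ?f (s n))) (Pair 1 (?f e)) sequentially"
    by (rule continuous_map_limit[rotated])
  then show ?thesis
    using mem unary_op_mem by (auto simp: clone_topology_def limitin_subtopology unary_op_def o_def)
qed

text \<open>Later this is the neighbourhood that tells the central swap from maps that fix the added
  points.\<close>

lemma openin_unary_value:
  "openin (clone_topology UNIV C) {F \<in> C \<inter> operations UNIV. fst F = 1 \<and> snd F (\<lambda>i\<in>{..<1}. a) = b}"
proof -
  let ?x = "\<lambda>i\<in>{..<1::nat}. a"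
  let ?U = "{F \<in> operations UNIV. fst F = 1 \<and> snd F ?x = b}"
  have "openin (operations_topology UNIV) ?U"
  proof -
    have "openin (product_topology (\<lambda>_. discrete_topology UNIV) (tuples k UNIV)) {f. (k, f) \<in> ?U}"
      if k: "k \<in> {1..}" for k
    proof (cases "k = 1")
      case True
      let ?T = "product_topology (\<lambda>_. discrete_topology UNIV) (tuples k UNIV) :: ((nat \<Rightarrow> 'a) \<Rightarrow> 'a) topology"
      have "openin ?T {f \<in> topspace ?T. f ?x \<in> {b}}"
        by (rule openin_continuous_map_preimage[where Y = "discrete_topology UNIV"])
          (use True in \<open>auto intro!: continuous_map_product_projection simp: tuples_UNIV\<close>)
      moreover have "{f \<in> topspace ?T. f ?x \<in> {b}} = {f. (k, f) \<in> ?U}"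
        using True by (auto simp: operations_def)
      ultimately show ?thesis by simp
    qed auto
    then show ?thesis
      unfolding operations_topology_def openin_sum_topology by (auto simp: operations_def)
  qed
  then have "openin (clone_topology UNIV C) (?U \<inter> C)"
    unfolding clone_topology_def by (rule openin_subtopology_Int)
  moreover have "?U \<inter> C = {F \<in> C \<inter> operations UNIV. fst F = 1 \<and> snd F ?x = b}" by auto
  ultimately show ?thesis by simp
qed

section \<open>A profinite group with a non-closed verbal subgroup\<close>

declare add_bit_eq_xor [simp del] mult_bit_eq_and [simp del]

text \<open>Written additively in order to use the class \<open>group_add\<close>, although the
  group is not commutative: the sum of matrices is twisted by a rank-one cocycle.\<close>

datatype gel = Gel (gv: "nat \<Rightarrow> bit") (gm: "nat \<Rightarrow> nat \<Rightarrow> bit")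

lemma gel_eqI: "(\<And>i. gv x i = gv y i) \<Longrightarrow> (\<And>i j. gm x i j = gm y i j) \<Longrightarrow> x = y"
  by (cases x; cases y) (simp add: fun_eq_iff)

lemma bit_add_self [simp]: "x + x = 0" "x + (x + y) = y" for x y :: bit
proof -
  show "x + x = 0" by (simp add: add_bit_eq_xor)
  then show "x + (x + y) = y" by (simp flip: add.assoc)
qed

instantiation gel :: group_add
begin

definition "0 = Gel (\<lambda>_. 0) (\<lambda>_ _. 0)"
definition "x + y = Gel (\<lambda>i. gv x i + gv y i) (\<lambda>i j. gm x i j + gm y i j + gv x i * gv y j)"
definition "- x = Gel (gv x) (\<lambda>i j. gm x i j + gv x i * gv x j)"
definition "x - y = x + - (y :: gel)"

lemma gel_sel [simp]:
  "gv (x + y) i = gv x i + gv y i" "gm (x + y) i j = gm x i j + gm y i j + gv x i * gv y j"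
  "gv 0 i = 0" "gm 0 i j = 0" "gv (- x) i = gv x i" "gm (- x) i j = gm x i j + gv x i * gv x j"
  by (simp_all add: zero_gel_def plus_gel_def uminus_gel_def)

instance
proof
  fix a b c :: gel
  show "a + b + c = a + (b + c)" by (rule gel_eqI) (simp_all add: ac_simps distrib_left distrib_right)
  show "0 + a = a" "a + 0 = a" "- a + a = 0" by (rule gel_eqI; simp)+
  show "a + - b = a - b" by (simp add: minus_gel_def)
qed

end

definition zc :: gel where
  "zc = Gel (\<lambda>_. 0) (\<lambda>i j. if i = j then 1 else 0)"

lemma zc_sel [simp]: "gv zc i = 0" "gm zc i j = (if i = j then 1 else 0)"
  by (simp_all add: zc_def)

text \<open>Congruence modulo the product of the \<open>r\<close>-th basic open normal subgroup with the subgroup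
  generated by \<open>zc\<close>.\<close>

definition close :: "nat \<Rightarrow> gel \<Rightarrow> gel \<Rightarrow> bool" where
  "close r x y \<longleftrightarrow> (\<forall>i<r. gv x i = gv y i) \<and>
     (\<exists>e. \<forall>i<r. \<forall>j<r. gm x i j = gm y i j + (if i = j then e else 0))"

lemma closeI:
  "(\<And>i. i < r \<Longrightarrow> gv x i = gv y i) \<Longrightarrow>
   (\<And>i j. i < r \<Longrightarrow> j < r \<Longrightarrow> gm x i j = gm y i j + (if i = j then e else 0)) \<Longrightarrow> close r x y"
  by (auto simp: close_def)

lemma close_refl [simp]: "close r x x"
  by (rule closeI[where e = 0]) auto

lemma close_sym: "close r x y \<Longrightarrow> close r y x"
proof -
  assume "close r x y"
  then obtain e where "\<forall>i<r. gv x i = gv y i" "\<forall>i<r. \<forall>j<r. gm x i j = gm y i j + (if i = j then e else 0)"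
    by (auto simp: close_def)
  then show ?thesis by (intro closeI[where e = e]) (auto simp: add.assoc)
qed

lemma close_trans [trans]: "close r x y \<Longrightarrow> close r y z \<Longrightarrow> close r x z"
proof -
  assume "close r x y" "close r y z"
  then obtain e e' where "\<forall>i<r. gv x i = gv y i" "\<forall>i<r. gv y i = gv z i"
      "\<forall>i<r. \<forall>j<r. gm x i j = gm y i j + (if i = j then e else 0)"
      "\<forall>i<r. \<forall>j<r. gm y i j = gm z i j + (if i = j then e' else 0)"
    unfolding close_def by blast
  then show ?thesis by (intro closeI[where e = "e + e'"]) (auto simp: ac_simps)
qed

lemma close_mono: "close r x y \<Longrightarrow> s \<le> r \<Longrightarrow> close s x y"
  unfolding close_def by (meson less_le_trans)

lemma close_add_left: "close r x y \<Longrightarrow> close r (g + x) (g + y)"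
proof -
  assume "close r x y"
  then obtain e where "\<forall>i<r. gv x i = gv y i" "\<forall>i<r. \<forall>j<r. gm x i j = gm y i j + (if i = j then e else 0)"
    by (auto simp: close_def)
  then show ?thesis by (intro closeI[where e = e]) (auto simp: ac_simps)
qed

lemma close_add_right: "close r x y \<Longrightarrow> close r (x + g) (y + g)"
proof -
  assume "close r x y"
  then obtain e where "\<forall>i<r. gv x i = gv y i" "\<forall>i<r. \<forall>j<r. gm x i j = gm y i j + (if i = j then e else 0)"
    by (auto simp: close_def)
  then show ?thesis by (intro closeI[where e = e]) (auto simp: ac_simps)
qed

lemma close_add_left_iff [simp]: "close r (g + x) (g + y) \<longleftrightarrow> close r x y"
  using close_add_left[of r "g + x" "g + y" "- g"] close_add_left by (auto simp: add.assoc[symmetric])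

lemma close_add_right_iff [simp]: "close r (x + g) (y + g) \<longleftrightarrow> close r x y"
  using close_add_right[of r "x + g" "y + g" "- g"] close_add_right by (auto simp: add.assoc)

lemma close_add_zc [simp]: "close r (x + zc) x" "close r x (x + zc)"
  by (rule closeI[where e = 1]; simp)+

text \<open>The bit \<open>e\<close> in \<open>close\<close> could depend on the level, but the
  entry at \<open>(0, 0)\<close> determines it at every positive level.\<close>

lemma close_all: 
  assumes "\<And>r. close r x y"
  shows "x = y \<or> x = y + zc"
proof -
  obtain e where e: "gm x 0 0 = gm y 0 0 + e"
    using assms[of 1] by (auto simp: close_def)
  have "gv x i = gv y i" for i using assms[of "Suc i"] by (auto simp: close_def)
  moreover have "gm x i j = gm y i j + (if i = j then e else 0)" for i j
  proof -
    obtain e' where e': "\<forall>i'<Suc (max i j). \<forall>j'<Suc (max i j). gm x i' j' = gm y i' j' + (if i' = j' then e' else 0)"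
      using assms[of "Suc (max i j)"] by (auto simp: close_def)
    then have "gm x 0 0 = gm y 0 0 + e'" by auto
    then have "e = e'" using e by simp
    then show ?thesis using e' by simp
  qed
  ultimately show ?thesis
    by (cases e) (auto intro!: gel_eqI)
qed

text \<open>Compactness of the quotient by \<open>zc\<close>. Choosing among \<open>x\<close> and
  \<open>x + zc\<close> the one with entry 0 at \<open>(0, 0)\<close> turns coherence modulo
  \<open>zc\<close> into equality of entries, which then stabilise.\<close>

lemma close_limit:
  assumes coh: "\<And>r s. r \<le> s \<Longrightarrow> close r (g s) (g r)"
  shows "\<exists>x. \<forall>r. close r x (g r)"
proof -
  define n where "n r x = (if gm x 0 0 = 0 then x else x + zc)" for r :: nat and x
  have n0: "gm (n r x) 0 0 = 0" for r x by (auto simp: n_def)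
  have nc: "close k (n r x) x" for k r x by (auto simp: n_def)
  define h where "h r = n r (g r)" for r
  have h: "close r (h s) (h r)" if "r \<le> s" for r s
    unfolding h_def using coh[OF that] nc close_sym close_trans by blast
  have hv: "gv (h s) i = gv (h r) i" if "r \<le> s" "i < r" for r s i
    using h[OF that(1)] that(2) by (auto simp: close_def)
  have hm: "gm (h s) i j = gm (h r) i j" if rij: "r \<le> s" "i < r" "j < r" for r s i j
  proof -
    obtain e where e: "\<forall>i<r. \<forall>j<r. gm (h s) i j = gm (h r) i j + (if i = j then e else 0)"
      using h[OF rij(1)] by (auto simp: close_def)
    moreover from this have "gm (h s) 0 0 = gm (h r) 0 0 + e" using rij by auto
    then have "e = 0" using n0 by (simp add: h_def)
    ultimately show ?thesis using rij by simp
  qed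
  define x where "x = Gel (\<lambda>i. gv (h (Suc i)) i) (\<lambda>i j. gm (h (Suc (max i j))) i j)"
  have "close r x (h r)" for r
  proof (rule closeI[where e = 0])
    show "gv x i = gv (h r) i" if "i < r" for i
      using hv[of "Suc i" r i] that by (simp add: x_def)
    show "gm x i j = gm (h r) i j + (if i = j then 0 else 0)" if "i < r" "j < r" for i j
      using hm[of "Suc (max i j)" r i j] that by (simp add: x_def)
  qed
  then show ?thesis unfolding h_def using nc close_trans by blast
qed

section \<open>Finite residues and a countable dense set\<close>

definition key :: "nat \<Rightarrow> gel \<Rightarrow> nat set \<times> (nat \<times> nat) set" where
  "key r x = ({i. i < r \<and> gv x i = 1}, {(i, j). i < r \<and> j < r \<and> gm x i j = 1})"

lemma finite_key: "finite (range (key r))"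
proof (rule finite_subset)
  show "range (key r) \<subseteq> Pow {..<r} \<times> Pow ({..<r} \<times> {..<r})" by (auto simp: key_def)
qed simp

lemma bit_eq_iff: "a = b \<longleftrightarrow> (a = 1 \<longleftrightarrow> b = 1)" for a b :: bit
  by (cases a; cases b) auto

lemma close_if_key: "key r x = key r y \<Longrightarrow> close r x y"
proof (rule closeI[where e = 0])
  assume k: "key r x = key r y"
  have "i < r \<and> gv x i = 1 \<longleftrightarrow> i < r \<and> gv y i = 1" for i
    using arg_cong[OF k, of fst] by (auto simp: key_def)
  then show "i < r \<Longrightarrow> gv x i = gv y i" for i using bit_eq_iff by blast
  have "(i, j) \<in> snd (key r x) \<longleftrightarrow> (i, j) \<in> snd (key r y)" for i j
    using k by simp
  then have "i < r \<and> j < r \<and> gm x i j = 1 \<longleftrightarrow> i < r \<and> j < r \<and> gm y i j = 1" for i j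
    by (simp add: key_def)
  then show "i < r \<Longrightarrow> j < r \<Longrightarrow> gm x i j = gm y i j + (if i = j then 0 else 0)" for i j
    using bit_eq_iff[of "gm x i j" "gm y i j"] by auto
qed

type_synonym gel_code = "nat list \<times> (nat \<times> nat) list"

text \<open>The elements with finite support are dense, and their codes form a countable type; this
  allows tasks to be numbered.\<close>

definition dec :: "gel_code \<Rightarrow> gel" where
  "dec c = Gel (\<lambda>i. of_bool (i \<in> set (fst c))) (\<lambda>i j. of_bool ((i, j) \<in> set (snd c)))"

lemma dec_dense: "\<exists>c. close r (dec c) x"
proof -
  obtain vs where vs: "set vs = {i. i < r \<and> gv x i = 1}"
    using finite_list[of "{i. i < r \<and> gv x i = 1}"] by auto
  have "finite {(i, j). i < r \<and> j < r \<and> gm x i j = 1}"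
    by (rule finite_subset[of _ "{..<r} \<times> {..<r}"]) auto
  then obtain ms where ms: "set ms = {(i, j). i < r \<and> j < r \<and> gm x i j = 1}"
    using finite_list by blast
  have "close r (dec (vs, ms)) x"
    by (rule closeI[where e = 0]) (auto simp: dec_def vs ms)
  then show ?thesis by blast
qed

text \<open>A continuous homomorphism to the integers modulo 4.\<close>

definition gbar :: "gel \<Rightarrow> nat" where
  "gbar x = of_bool (gv x 0 = 1) + 2 * of_bool (gm x 0 0 = 1)"

text \<open>The term \<open>gv x 0 * gv y 0\<close> in the matrix entry is the carry in the addition
  of the two low bits.\<close>

lemma gbar_add: "gbar (x + y) mod 4 = (gbar x + gbar y) mod 4"
  by (cases "gv x 0"; cases "gv y 0"; cases "gm x 0 0"; cases "gm y 0 0"; simp add: gbar_def)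

lemma gbar_close: "close 1 x y \<Longrightarrow> gbar x = gbar y \<or> gbar x = gbar (y + zc)"
  by (cases "gm x 0 0"; cases "gm y 0 0"; simp add: gbar_def close_def)

text \<open>A finite sum of rank-one matrices has only finitely many distinct rows, whereas the rows of the
  identity matrix are pairwise distinct.\<close>

lemma discontinuous_functional:
  "\<exists>lam :: (nat \<Rightarrow> nat \<Rightarrow> bit) \<Rightarrow> bit. (\<forall>a b. lam (\<lambda>i j. a i j + b i j) = lam a + lam b) \<and>
     (\<forall>v w. lam (\<lambda>i j. v i * w j) = 0) \<and> lam (\<lambda>i j. if i = j then 1 else 0) = 1"
proof -
  define sc where "sc = (\<lambda>(c :: bit) (a :: nat \<Rightarrow> nat \<Rightarrow> bit). (\<lambda>i j. c * a i j))"
  interpret vector_space sc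
    by standard (auto simp: sc_def fun_eq_iff algebra_simps)
  define T where "T = {a :: nat \<Rightarrow> nat \<Rightarrow> bit. finite (range a)}"
  define I where "I = (\<lambda>i j :: nat. if i = j then 1 else 0 :: bit)"
  have "subspace T"
  proof (rule subspaceI)
    show "0 \<in> T" by (simp add: T_def zero_fun_def)
  next
    fix a b assume "a \<in> T" "b \<in> T"
    then have "finite ((\<lambda>(x, y) j. x j + y j) ` (range a \<times> range b))" by (simp add: T_def)
    moreover have "range (a + b) \<subseteq> (\<lambda>(x, y) j. x j + y j) ` (range a \<times> range b)"
      by (auto simp: fun_eq_iff image_iff) blast
    ultimately show "a + b \<in> T" unfolding T_def using finite_subset by blast
  next
    fix c a assume "a \<in> T"
    then have "finite ((\<lambda>x j. c * x j) ` range a)" by (simp add: T_def)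
    moreover have "range (sc c a) \<subseteq> (\<lambda>x j. c * x j) ` range a" by (auto simp: sc_def)
    ultimately show "sc c a \<in> T" unfolding T_def using finite_subset by blast
  qed
  have "inj I"
  proof (rule injI)
    fix i k assume "I i = I k"
    then have "I i i = I k i" by simp
    then show "i = k" by (simp add: I_def split: if_splits)
  qed
  then have "I \<notin> T" using finite_imageD[of I UNIV] unfolding T_def by blast
  obtain B where "B \<subseteq> T" "independent B" "T \<subseteq> span B"
    by (rule maximal_independent_subset[of T])
  then have B: "B \<subseteq> T" "independent B" "span B = T"
    using span_subspace[OF _ _ \<open>subspace T\<close>] by auto
  have ind: "independent (insert I B)"
    using B \<open>I \<notin> T\<close> by (simp add: independent_insertI)
  define E where "E = extend_basis (insert I B)"
  have E: "independent E" "span E = UNIV" "I \<in> E" "B \<subseteq> E"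
    using extend_basis_superset[OF ind] independent_extend_basis[OF ind] span_extend_basis[OF ind]
    by (auto simp: E_def)
  \<comment> \<open>The coordinate at \<open>I\<close> in a basis containing \<open>I\<close> and a
    basis of \<open>T\<close>; it vanishes on \<open>T\<close>, in particular on rank-one
    matrices.\<close>
  define lam where "lam a = representation E a I" for a
  have "lam (a + b) = lam a + lam b" for a b
    using representation_add[OF E(1)] E(2) by (simp add: lam_def)
  then have "lam (\<lambda>i j. a i j + b i j) = lam a + lam b" for a b
    by (simp add: plus_fun_def)
  moreover have "lam (\<lambda>i j. v i * w j) = 0" for v w
  proof -
    have "(\<lambda>i j. v i * w j) \<in> T"
    proof -
      have "range (\<lambda>i j. v i * w j) \<subseteq> (\<lambda>c j. c * w j) ` {0, 1}"
      proof
        fix x assume "x \<in> range (\<lambda>i j. v i * w j)"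
        then obtain i where "x = (\<lambda>j. v i * w j)" by blast
        moreover have "v i \<in> {0, 1}" by (cases "v i") auto
        ultimately show "x \<in> (\<lambda>c j. c * w j) ` {0, 1}" by blast
      qed
      then show ?thesis unfolding T_def using finite_subset by blast
    qed
    then have "lam (\<lambda>i j. v i * w j) = representation B (\<lambda>i j. v i * w j) I"
      using representation_extend[OF E(1) _ E(4)] B by (simp add: lam_def)
    moreover have "I \<notin> B" using B \<open>I \<notin> T\<close> by blast
    ultimately show ?thesis using representation_ne_zero by metis
  qed
  moreover have "lam I = 1"
    using representation_basis[OF E(1,3)] by (simp add: lam_def)
  ultimately show ?thesis unfolding I_def by blast
qed

definition lam :: "(nat \<Rightarrow> nat \<Rightarrow> bit) \<Rightarrow> bit" where
  "lam = (SOME lam. (\<forall>a b. lam (\<lambda>i j. a i j + b i j) = lam a + lam b) \<and>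
     (\<forall>v w. lam (\<lambda>i j. v i * w j) = 0) \<and> lam (\<lambda>i j. if i = j then 1 else 0) = 1)"

lemma lam:
  "lam (\<lambda>i j. a i j + b i j) = lam a + lam b"
  "lam (\<lambda>i j. v i * w j) = 0"
  "lam (\<lambda>i j. if i = j then 1 else 0) = 1"
  using someI_ex[OF discontinuous_functional] unfolding lam_def by blast+

definition phi :: "gel \<Rightarrow> nat" where
  "phi x = of_bool (lam (gm x) = 1)"

text \<open>The cocycle is a rank-one matrix, so \<open>lam\<close> does not see it; hence
  \<open>phi\<close> is a homomorphism modulo 2.\<close>

lemma lam_gm_add: "lam (gm (x + y)) = lam (gm x) + lam (gm y)"
proof -
  have "gm (x + y) = (\<lambda>i j. (gm x i j + gm y i j) + gv x i * gv y j)" by (auto simp: fun_eq_iff)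
  then show ?thesis by (simp add: lam)
qed

lemma lam_gm_zc: "lam (gm zc) = 1"
  using lam(3) by (simp add: zc_def)

lemma phi_add: "phi (x + y) mod 2 = (phi x + phi y) mod 2"
  by (cases "lam (gm x)"; cases "lam (gm y)") (auto simp: phi_def lam_gm_add)

lemma phi_zc: "phi zc mod 2 \<noteq> 0"
  by (simp add: phi_def lam_gm_zc)

lemma phi_add_zc: "phi x = phi y \<or> phi x = phi (y + zc)"
  by (cases "lam (gm x)"; cases "lam (gm y)") (auto simp: phi_def lam_gm_add lam_gm_zc)

text \<open>Products of squares of the elements \<open>unit_vec\<close>, tending to
  \<open>zc\<close>.\<close>

definition diag :: "nat \<Rightarrow> gel" where
  "diag k = Gel (\<lambda>_. 0) (\<lambda>i j. if i = j \<and> i < k then 1 else 0)"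

definition unit_vec :: "nat \<Rightarrow> gel" where
  "unit_vec k = Gel (\<lambda>i. if i = k then 1 else 0) (\<lambda>_ _. 0)"

lemma diag_0: "diag 0 = 0"
  by (rule gel_eqI) (simp_all add: diag_def)

lemma diag_Suc: "diag (Suc k) = diag k + (unit_vec k + unit_vec k)"
  by (rule gel_eqI) (auto simp: diag_def unit_vec_def)

text \<open>\<open>diag k\<close> agrees with \<open>zc\<close> below \<open>k\<close>, and
  \<open>close\<close> identifies \<open>zc\<close> with 0.\<close>

lemma close_diag: "r \<le> k \<Longrightarrow> close r (diag k) 0"
  by (rule closeI[where e = 1]) (auto simp: diag_def)

lemma gbar_diag: "0 < k \<Longrightarrow> gbar (diag k) = gbar zc"
  by (simp add: gbar_def diag_def)

section \<open>A generic equivariant colouring\<close>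

definition coset :: "nat \<Rightarrow> gel \<Rightarrow> gel set" where
  "coset k g = {h. close k g h}"

text \<open>The disjoint union of the finite quotients of the group modulo \<open>zc\<close>. Under
  translation, the stabiliser of each point of level \<open>k\<close> consists of the elements
  \<open>close k\<close> to 0; these subgroups intersect in 0 and \<open>zc\<close>.\<close>

definition points :: "(nat \<times> gel set) set" where
  "points = {(k, coset k g) | k g. True}"

definition lvl :: "nat \<Rightarrow> nat" where
  "lvl n = fst (from_nat_into points n)"

definition act :: "gel \<Rightarrow> nat \<Rightarrow> nat" where
  "act g n = to_nat_on points (case from_nat_into points n of (k, Q) \<Rightarrow> (k, (+) g ` Q))"

text \<open>The trivial coset represents its level; the levels are the orbits of the action.\<close>

definition base :: "nat \<Rightarrow> nat" where
  "base k = to_nat_on points (k, coset k 0)"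

lemma coset_eq_iff: "coset k g = coset k h \<longleftrightarrow> close k g h"
  unfolding coset_def using close_sym close_trans close_refl by blast

lemma coset_shift: "(+) g ` coset k h = coset k (g + h)"
proof -
  have "x \<in> (+) g ` coset k h" if "close k (g + h) x" for x
  proof
    show "x = g + (- g + x)" by (simp flip: add.assoc)
    have "close k (- g + (g + h)) (- g + x)" using that by (simp only: close_add_left_iff)
    then have "close k h (- g + x)" by (simp only: minus_add_cancel)
    then show "- g + x \<in> coset k h" by (simp add: coset_def)
  qed
  then show ?thesis by (auto simp: coset_def)
qed

lemma finite_coset: "finite (range (coset k))"
proof -
  have "range (coset k) \<subseteq> (\<lambda>c. coset k (SOME g. key k g = c)) ` range (key k)"
  proof
    fix Q assume "Q \<in> range (coset k)"
    then obtain g where g: "Q = coset k g" by blast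
    have "key k (SOME g'. key k g' = key k g) = key k g" by (rule someI) simp
    then have "Q = coset k (SOME g'. key k g' = key k g)"
      using close_if_key g coset_eq_iff by blast
    then show "Q \<in> (\<lambda>c. coset k (SOME g. key k g = c)) ` range (key k)" by blast
  qed
  then show ?thesis using finite_key finite_surj by blast
qed

lemma points_Sigma: "points = (SIGMA k:UNIV. range (coset k))"
  by (auto simp: points_def)

lemma countable_points: "countable points"
  unfolding points_Sigma by (intro countable_SIGMA countable_finite[OF finite_coset]) simp

lemma infinite_points: "infinite points"
proof
  assume "finite points"
  then have "finite (fst ` points)" by (rule finite_imageI)
  moreover have "k \<in> fst ` points" for k
    by (rule image_eqI[of _ _ "(k, coset k 0)"]) (auto simp: points_def)
  ultimately show False by (metis UNIV_eq_I infinite_UNIV_nat)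
qed

lemma point_cases: obtains g where "from_nat_into points n = (lvl n, coset (lvl n) g)"
proof -
  have "from_nat_into points n \<in> points"
    using infinite_points by (intro from_nat_into) auto
  then obtain k g where "from_nat_into points n = (k, coset k g)" unfolding points_def by blast
  then show ?thesis using that by (simp add: lvl_def)
qed

lemma from_to_points: "from_nat_into points (to_nat_on points (k, coset k g)) = (k, coset k g)"
  by (rule from_nat_into_to_nat_on[OF countable_points]) (auto simp: points_def)

lemma to_from_points: "to_nat_on points (from_nat_into points n) = n"
  by (rule to_nat_on_from_nat_into_infinite[OF countable_points infinite_points])

lemma point_eqI: "from_nat_into points n = from_nat_into points m \<Longrightarrow> n = m"
  by (metis to_from_points)

lemma from_act:
  "from_nat_into points n = (k, coset k h) \<Longrightarrow> from_nat_into points (act g n) = (k, coset k (g + h))"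
  by (simp add: act_def coset_shift from_to_points)

lemma lvl_act [simp]: "lvl (act g n) = lvl n"
proof -
  obtain x where x: "from_nat_into points n = (lvl n, coset (lvl n) x)" by (rule point_cases)
  show ?thesis using from_act[OF x, of g] by (simp add: lvl_def[of "act g n"])
qed

lemma lvl_base [simp]: "lvl (base k) = k"
  by (simp add: base_def lvl_def from_to_points)

lemma act_add: "act (g + h) n = act g (act h n)"
proof -
  obtain x where x: "from_nat_into points n = (lvl n, coset (lvl n) x)" by (rule point_cases)
  show ?thesis
    by (rule point_eqI) (simp add: from_act[OF from_act[OF x]] from_act[OF x] add.assoc)
qed

lemma act_0 [simp]: "act 0 n = n"
proof -
  obtain x where x: "from_nat_into points n = (lvl n, coset (lvl n) x)" by (rule point_cases)
  show ?thesis by (rule point_eqI) (simp add: from_act[OF x] x)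
qed

lemma act_minus [simp]: "act (- g) (act g n) = n" "act g (act (- g) n) = n"
  by (simp_all flip: act_add)

lemma act_cong: "close (lvl n) g h \<Longrightarrow> act g n = act h n"
proof -
  assume "close (lvl n) g h"
  moreover obtain x where x: "from_nat_into points n = (lvl n, coset (lvl n) x)" by (rule point_cases)
  ultimately show ?thesis
    by (intro point_eqI) (simp add: from_act[OF x] coset_eq_iff close_add_right)
qed

lemma act_base_eq_iff: "act g (base k) = act h (base k) \<longleftrightarrow> close k g h"
proof
  have x: "from_nat_into points (base k) = (k, coset k 0)" by (simp add: base_def from_to_points)
  assume "act g (base k) = act h (base k)"
  then have "(k, coset k (g + 0)) = (k, coset k (h + 0))" by (metis from_act[OF x])
  then show "close k g h" by (simp add: coset_eq_iff)
qed (simp add: act_cong)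

lemma act_base_transitive: "\<exists>g. act g (base (lvl n)) = n"
proof -
  obtain x where x: "from_nat_into points n = (lvl n, coset (lvl n) x)" by (rule point_cases)
  have "from_nat_into points (base k) = (k, coset k 0)" for k by (simp add: base_def from_to_points)
  then have "from_nat_into points (act x (base (lvl n))) = (lvl n, coset (lvl n) (x + 0))"
    using from_act by blast
  then show ?thesis using x by (intro exI[of _ x] point_eqI) simp
qed

lemma finite_lvl: "finite {n. lvl n < r}"
proof -
  have "finite (to_nat_on points ` (SIGMA k:{..<r}. range (coset k)))"
    using finite_coset by auto
  moreover have "{n. lvl n < r} \<subseteq> to_nat_on points ` (SIGMA k:{..<r}. range (coset k))"
  proof
    fix n assume "n \<in> {n. lvl n < r}"
    moreover obtain x where "from_nat_into points n = (lvl n, coset (lvl n) x)" by (rule point_cases)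
    ultimately have "from_nat_into points n \<in> (SIGMA k:{..<r}. range (coset k))" by simp
    then show "n \<in> to_nat_on points ` (SIGMA k:{..<r}. range (coset k))"
      by (metis image_eqI to_from_points)
  qed
  ultimately show ?thesis by (rule finite_subset[rotated])
qed

text \<open>The least length that forces a repetition-free list to contain a point of level at least \<open>r\<close>,
  so that any group element fixing the list is \<open>close r\<close> to 0.\<close>

definition ar :: "nat \<Rightarrow> nat" where
  "ar r = Suc (card {n. lvl n < r})"

lemma less_ar: "r < ar r"
proof -
  have "inj base" by (rule injI) (metis lvl_base)
  then have "card (base ` {..<r}) = r" by (simp add: card_image inj_on_subset)
  moreover have "card (base ` {..<r}) \<le> card {n. lvl n < r}"
    by (rule card_mono[OF finite_lvl]) auto
  ultimately show ?thesis by (simp add: ar_def)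
qed

lemma ar_mono: "r \<le> s \<Longrightarrow> ar r \<le> ar s"
  unfolding ar_def by (simp, rule card_mono[OF finite_lvl]) auto

lemma deep_member:
  assumes "distinct xs" "ar r \<le> length xs"
  shows "\<exists>n\<in>set xs. r \<le> lvl n"
proof (rule ccontr)
  assume "\<not> ?thesis"
  then have "card (set xs) \<le> card {n. lvl n < r}"
    by (intro card_mono[OF finite_lvl]) auto
  then show False using assms by (simp add: distinct_card ar_def)
qed

section \<open>The equivariant colouring and its extension property\<close>

definition top_lvl :: "nat list \<Rightarrow> nat" where
  "top_lvl xs = Max (lvl ` set xs)"

text \<open>Selecting by position in the list makes the choice commute with the action, which
  preserves levels.\<close>

definition lead :: "nat list \<Rightarrow> nat" where
  "lead xs = hd (filter (\<lambda>n. lvl n = top_lvl xs) xs)"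

text \<open>Determined only up to \<open>close (top_lvl xs)\<close>, which suffices for
  \<open>col_act\<close>.\<close>

definition mover :: "nat list \<Rightarrow> gel" where
  "mover xs = (SOME g. act g (base (top_lvl xs)) = lead xs)"

text \<open>The \<open>k\<close>-th task prescribes the colours of lists that contain the point \<open>base k\<close>, represented by
  \<open>None\<close>, and otherwise only points of lower level. Every task occurs for arbitrarily large \<open>k\<close>.\<close>

definition mark :: "nat \<Rightarrow> nat \<Rightarrow> nat option" where
  "mark d n = (if n = d then None else Some n)"

definition task :: "nat \<Rightarrow> nat option list \<Rightarrow> gel" where
  "task k q = (case map_of (from_nat (fst (prod_decode k)) :: (nat option list \<times> gel_code) list) q of
     None \<Rightarrow> 0 | Some c \<Rightarrow> dec c)"

text \<open>A list is moved by the group until its leading point is \<open>base k\<close>, coloured according to the task,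
  and moved back: this makes the colouring equivariant.\<close>

definition col :: "nat list \<Rightarrow> gel" where
  "col xs = mover xs +
     task (top_lvl xs) (map (mark (base (top_lvl xs))) (map (act (- mover xs)) xs))"

lemma lvl_le_top: "n \<in> set xs \<Longrightarrow> lvl n \<le> top_lvl xs"
  by (simp add: top_lvl_def)

lemma lead_filter:
  assumes "xs \<noteq> []"
  shows "filter (\<lambda>n. lvl n = top_lvl xs) xs \<noteq> []"
proof -
  have "top_lvl xs \<in> lvl ` set xs" unfolding top_lvl_def using assms by (intro Max_in) auto
  then show ?thesis by (auto simp: filter_empty_conv)
qed

lemma lead_mem: "xs \<noteq> [] \<Longrightarrow> lead xs \<in> set xs" "xs \<noteq> [] \<Longrightarrow> lvl (lead xs) = top_lvl xs"
  using hd_in_set[OF lead_filter] unfolding lead_def by auto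

lemma act_mover: "xs \<noteq> [] \<Longrightarrow> act (mover xs) (base (top_lvl xs)) = lead xs"
  unfolding mover_def using someI_ex[OF act_base_transitive[of "lead xs"]] lead_mem(2) by simp

lemma top_lvl_act: "top_lvl (map (act h) xs) = top_lvl xs"
  by (simp add: top_lvl_def image_image)

lemma lead_act: "xs \<noteq> [] \<Longrightarrow> lead (map (act h) xs) = act h (lead xs)"
  unfolding lead_def top_lvl_act using lead_filter[of xs] by (simp add: filter_map o_def hd_map)

text \<open>The movers of the two lists differ by \<open>h\<close>, up to the top level. Moving back
  therefore yields the same list, hence the same task value, and only the movers contribute.\<close>

lemma col_act:
  assumes "xs \<noteq> []"
  shows "close (top_lvl xs) (col (map (act h) xs)) (h + col xs)"
proof -
  let ?k = "top_lvl xs" and ?g = "mover xs" and ?g' = "mover (map (act h) xs)"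
  have "act ?g' (base ?k) = act (h + ?g) (base ?k)"
    using act_mover[of "map (act h) xs"] act_mover[OF assms] assms
    by (simp add: top_lvl_act lead_act act_add)
  then have g: "close ?k ?g' (h + ?g)" by (simp add: act_base_eq_iff)
  have "close ?k (- ?g' + h) (- ?g)"
  proof -
    have "close ?k (- ?g' + (?g' + - ?g)) (- ?g' + (h + ?g + - ?g))"
      using g by (simp only: close_add_left_iff close_add_right_iff)
    then have "close ?k (- ?g) (- ?g' + h)"
      by (simp only: minus_add_cancel add_minus_cancel add.assoc right_minus add_0_right)
    then show ?thesis by (rule close_sym)
  qed
  then have "act (- ?g') (act h n) = act (- ?g) n" if "n \<in> set xs" for n
    using act_cong[OF close_mono[OF _ lvl_le_top[OF that]]] by (simp flip: act_add)
  then have eq: "map (act (- ?g')) (map (act h) xs) = map (act (- ?g)) xs" by simp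
  show ?thesis
    unfolding col_def top_lvl_act eq using g by (simp flip: add.assoc)
qed

lemma close_col_act:
  assumes "distinct xs" "ar r \<le> length xs"
  shows "close r (col (map (act h) xs)) (h + col xs)"
proof -
  obtain n where "n \<in> set xs" "r \<le> lvl n" using deep_member[OF assms] by blast
  then have "r \<le> top_lvl xs" "xs \<noteq> []" using lvl_le_top[of n xs] by auto
  then show ?thesis using col_act close_mono by blast
qed

text \<open>Genericity. \<open>d\<close> is a base point above all levels in \<open>F\<close>: it
  leads every list over \<open>insert d F\<close> that contains it, and the mover of such a list is
  trivial up to the level of \<open>d\<close>, so the colour is the task value.\<close>

lemma col_extension:
  assumes F: "finite F"
  shows "\<exists>d. d \<notin> F \<and> (\<forall>xs r. distinct xs \<longrightarrow> set xs \<subseteq> insert d F \<longrightarrow> d \<in> set xs \<longrightarrow>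
    ar r \<le> length xs \<longrightarrow> close r (col xs) (p (map (mark d) xs)))"
proof -
  \<comment> \<open>A repetition-free list over \<open>insert d F\<close> has at most
    \<open>R\<close> entries, so finitely many patterns occur and precision \<open>R\<close> is
    enough for all of them.\<close>
  define R where "R = Suc (card F)"
  have "finite {q. set q \<subseteq> insert None (Some ` F) \<and> length q \<le> R}"
    by (rule finite_lists_length_le) (use F in auto)
  then obtain qs where qs: "set qs = {q. set q \<subseteq> insert None (Some ` F) \<and> length q \<le> R}"
    using finite_list by blast
  obtain c where c: "\<And>q. close R (dec (c q)) (p q)"
    using choice[of "\<lambda>q c. close R (dec c) (p q)"] dec_dense by blast
  define t where "t = map (\<lambda>q. (q, c q)) qs"
  \<comment> \<open>The second component of \<open>k\<close> does not affect the task; it lifts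
    \<open>k\<close> above the levels in \<open>F\<close>.\<close>
  define j where "j = Suc (Max (insert 0 (lvl ` F)))"
  define k where "k = prod_encode (to_nat t, j)"
  have task: "task k q = dec (c q)" if "q \<in> set qs" for q
    using that by (simp add: task_def k_def t_def map_of_map_restrict)
  have lvlF: "lvl n < k" if "n \<in> F" for n
  proof -
    have "lvl n < j" using that F by (simp add: j_def less_Suc_eq_le)
    also have "j \<le> k" unfolding k_def by (rule le_prod_encode_2)
    finally show ?thesis .
  qed
  have "close r (col xs) (p (map (mark (base k)) xs))"
    if xs: "distinct xs" "set xs \<subseteq> insert (base k) F" "base k \<in> set xs" "ar r \<le> length xs" for xs r
  proof -
    have "lvl n \<le> k" if "n \<in> set xs" for n using that xs lvlF by (auto simp: less_imp_le)
    moreover have "k \<in> lvl ` set xs" using xs(3) by force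
    ultimately have top: "top_lvl xs = k" unfolding top_lvl_def by (intro Max_eqI) auto
    have ne: "xs \<noteq> []" using xs by auto
    have "lead xs = base k"
      using lead_mem[OF ne] xs(2) lvlF top by fastforce
    then have "act (mover xs) (base k) = act 0 (base k)" using act_mover[OF ne] top by simp
    then have m: "close k (mover xs) 0" by (simp only: act_base_eq_iff)
    have m': "close k (- mover xs) 0"
    proof -
      have "close k (- mover xs + mover xs) (- mover xs + 0)"
        using m by (simp only: close_add_left_iff)
      then show ?thesis by (simp add: close_sym)
    qed
    have "act (- mover xs) n = n" if "n \<in> set xs" for n
      using act_cong[OF close_mono[OF m']] lvl_le_top[OF that] top by fastforce
    then have "map (act (- mover xs)) xs = xs" by (simp add: map_idI)
    then have col: "col xs = mover xs + task k (map (mark (base k)) xs)" by (simp add: col_def top)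
    have "length xs \<le> R"
      using card_mono[OF _ xs(2)] F xs(1) by (simp add: R_def distinct_card card_insert_if split: if_splits)
    then have q: "map (mark (base k)) xs \<in> set qs"
      using xs(2) by (auto simp: qs mark_def)
    have "close k (col xs) (dec (c (map (mark (base k)) xs)))"
      using close_add_right[OF m] by (simp add: col task[OF q])
    moreover have "r \<le> k" using deep_member[OF xs(1,4)] lvl_le_top[of _ xs] top by fastforce
    ultimately have "close r (col xs) (dec (c (map (mark (base k)) xs)))" using close_mono by blast
    also have "close r (dec (c (map (mark (base k)) xs))) (p (map (mark (base k)) xs))"
      by (rule close_mono[OF c]) (use less_ar[of r] xs(4) \<open>length xs \<le> R\<close> in simp)
    finally show ?thesis .
  qed
  moreover have "base k \<notin> F" using lvlF by force
  ultimately show ?thesis by blast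
qed

text \<open>Demanding \<open>ar r \<le> length xs\<close> admits every \<open>act g\<close> and
  bounds the precision at which lists of a given length are compared; the latter makes the number of
  orbits finite.\<close>

definition pres :: "gel \<Rightarrow> (nat \<Rightarrow> nat) \<Rightarrow> bool" where
  "pres g \<sigma> \<longleftrightarrow> (\<forall>xs r. distinct xs \<longrightarrow> ar r \<le> length xs \<longrightarrow> close r (col (map \<sigma> xs)) (g + col xs))"

lemma presD:
  "pres g \<sigma> \<Longrightarrow> distinct xs \<Longrightarrow> ar r \<le> length xs \<Longrightarrow> close r (col (map \<sigma> xs)) (g + col xs)"
  by (simp add: pres_def)

section \<open>Homogeneity of the coloured set\<close>

definition partial_iso :: "(nat \<times> nat) list \<Rightarrow> bool" where
  "partial_iso l \<longleftrightarrow> (\<forall>z\<in>set l. \<forall>z'\<in>set l. fst z = fst z' \<longleftrightarrow> snd z = snd z') \<and>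
     (\<forall>zs r. set zs \<subseteq> set l \<longrightarrow> distinct zs \<longrightarrow> ar r \<le> length zs \<longrightarrow>
        close r (col (map snd zs)) (col (map fst zs)))"

lemma partial_iso_cong: "set l = set l' \<Longrightarrow> partial_iso l \<longleftrightarrow> partial_iso l'"
  by (simp add: partial_iso_def)

lemma partial_iso_swap:
  assumes "partial_iso l"
  shows "partial_iso (map prod.swap l)"
  unfolding partial_iso_def
proof (intro conjI allI impI)
  show "\<forall>z\<in>set (map prod.swap l). \<forall>z'\<in>set (map prod.swap l). fst z = fst z' \<longleftrightarrow> snd z = snd z'"
    using assms by (auto simp: partial_iso_def)
  fix zs r assume zs: "set zs \<subseteq> set (map prod.swap l)" "distinct zs" "ar r \<le> length zs"
  have "set (map prod.swap zs) \<subseteq> set l" using zs(1) by auto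
  moreover have "distinct (map prod.swap zs)" using zs(2) by (simp add: distinct_map)
  ultimately have "close r (col (map snd (map prod.swap zs))) (col (map fst (map prod.swap zs)))"
    using assms zs(3) unfolding partial_iso_def by (metis length_map)
  then show "close r (col (map snd zs)) (col (map fst zs))"
    by (simp add: o_def close_sym)
qed

text \<open>\<open>x\<close> is matched with a generic \<open>d\<close> whose colours over the old
  second components copy those of \<open>x\<close> over the old first ones.\<close>

lemma partial_iso_extend:
  assumes l: "partial_iso l"
  shows "\<exists>y. partial_iso (l @ [(x, y)])"
proof (cases "x \<in> fst ` set l")
  case True
  then obtain y where "(x, y) \<in> set l" by force
  then have "partial_iso (l @ [(x, y)])" using l by (subst partial_iso_cong[of _ l]) auto
  then show ?thesis by blast
next
  case False
  have inj: "fst z = fst z' \<longleftrightarrow> snd z = snd z'" if "z \<in> set l" "z' \<in> set l" for z z'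
    using l that by (simp add: partial_iso_def)
  define f where "f b = (THE a. (a, b) \<in> set l)" for b
  have f: "f (snd z) = fst z" if "z \<in> set l" for z
    unfolding f_def
  proof (rule the_equality)
    show "(fst z, snd z) \<in> set l" using that by simp
    show "a = fst z" if "(a, snd z) \<in> set l" for a using inj[OF that \<open>z \<in> set l\<close>] by simp
  qed
  \<comment> \<open>The prescribed colour of a pattern is that of its pullback: \<open>f\<close>
    inverts the partial map, and \<open>None\<close>, which stands for \<open>d\<close>, becomes
    \<open>x\<close>.\<close>
  obtain d where d: "d \<notin> snd ` set l"
      "\<And>xs r. distinct xs \<Longrightarrow> set xs \<subseteq> insert d (snd ` set l) \<Longrightarrow> d \<in> set xs \<Longrightarrow> ar r \<le> length xs \<Longrightarrow>
        close r (col xs) (col (map (case_option x f) (map (mark d) xs)))"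
    using col_extension[of "snd ` set l" "\<lambda>q. col (map (case_option x f) q)"] by auto
  have inj': "fst z = fst z' \<longleftrightarrow> snd z = snd z'" if "z \<in> insert (x, d) (set l)" "z' \<in> insert (x, d) (set l)" for z z'
  proof -
    have "fst w \<noteq> x" "snd w \<noteq> d" if "w \<in> set l" for w using that False d(1) by auto
    then show ?thesis using inj that by (metis fst_conv insertE snd_conv)
  qed
  have "close r (col (map snd zs)) (col (map fst zs))"
    if zs: "set zs \<subseteq> insert (x, d) (set l)" "distinct zs" "ar r \<le> length zs" for zs r
  proof (cases "(x, d) \<in> set zs")
    case True
    have "inj_on snd (set zs)"
    proof (rule inj_onI)
      fix z z' assume "z \<in> set zs" "z' \<in> set zs" "snd z = snd z'"
      then show "z = z'" using inj'[of z z'] zs(1) by (auto intro: prod_eqI)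
    qed
    then have "distinct (map snd zs)" using zs(2) by (simp add: distinct_map)
    then have "close r (col (map snd zs)) (col (map (case_option x f) (map (mark d) (map snd zs))))"
      using True zs by (intro d(2)) force+
    also have "map (case_option x f) (map (mark d) (map snd zs)) = map fst zs"
      unfolding map_map
    proof (intro map_cong refl)
      fix z assume "z \<in> set zs"
      then consider "z = (x, d)" | "z \<in> set l" using zs(1) by auto
      then show "(case_option x f \<circ> (mark d \<circ> snd)) z = fst z"
        using d(1) f by cases (auto simp: mark_def)
    qed
    finally show ?thesis .
  next
    case False
    then show ?thesis using l zs unfolding partial_iso_def by blast
  qed
  then have "partial_iso (l @ [(x, d)])" using inj' by (simp add: partial_iso_def)
  then show ?thesis by blast
qed

lemma partial_iso_total:
  assumes l: "partial_iso l"
  obtains \<sigma> where "bij \<sigma>" "pres 0 \<sigma>" "\<And>a b. (a, b) \<in> set l \<Longrightarrow> \<sigma> a = b"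
proof -
  \<comment> \<open>The backward step is the forward one for the inverse partial map.\<close>
  have bwd: "\<exists>x. partial_iso (m @ [(x, y)])" if m: "partial_iso m" for m y
  proof -
    obtain x where "partial_iso (map prod.swap m @ [(y, x)])"
      using partial_iso_extend[OF partial_iso_swap[OF m]] by blast
    from partial_iso_swap[OF this] show ?thesis by (auto simp: o_def)
  qed
  obtain R where R: "R \<subseteq> UNIV \<times> UNIV" "set l \<subseteq> R" "fst ` R = UNIV" "snd ` R = UNIV"
      "\<And>F. finite F \<Longrightarrow> F \<subseteq> R \<Longrightarrow> \<exists>l. partial_iso l \<and> F \<subseteq> set l \<and> set l \<subseteq> R"
    by (rule back_and_forth[of UNIV UNIV partial_iso l])
      (use l partial_iso_extend bwd in \<open>auto simp: countableI_type\<close>)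
  have inj: "fst z = fst z' \<longleftrightarrow> snd z = snd z'" if zz: "z \<in> R" "z' \<in> R" for z z'
    using R(5)[of "{z, z'}"] zz by (auto simp: partial_iso_def)
  have "\<exists>b. (a, b) \<in> R" for a using R(3) by (metis UNIV_I imageE prod.collapse)
  then obtain \<sigma> where \<sigma>: "\<And>a. (a, \<sigma> a) \<in> R" by metis
  have \<sigma>_eq: "\<sigma> a = b" if "(a, b) \<in> R" for a b using inj[OF that \<sigma>[of a]] by simp
  show ?thesis
  proof (rule that)
    show "bij \<sigma>"
    proof (rule bijI)
      show "inj \<sigma>" by (rule injI) (use inj[OF \<sigma> \<sigma>] in simp)
      show "surj \<sigma>" using R(4) \<sigma>_eq unfolding surj_def by (metis UNIV_I imageE prod.collapse)
    qed
    show "pres 0 \<sigma>"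
      unfolding pres_def
    proof (intro allI impI)
      fix xs :: "nat list" and r assume xs: "distinct xs" "ar r \<le> length xs"
      let ?zs = "map (\<lambda>a. (a, \<sigma> a)) xs"
      have "set ?zs \<subseteq> R" using \<sigma> by auto
      then obtain l' where l': "partial_iso l'" "set ?zs \<subseteq> set l'" using R(5)[of "set ?zs"] by auto
      have "distinct ?zs" using xs(1) by (simp add: distinct_map inj_on_def)
      then have "close r (col (map snd ?zs)) (col (map fst ?zs))"
        using l' xs(2) unfolding partial_iso_def by (metis length_map)
      then show "close r (col (map \<sigma> xs)) (0 + col xs)" by (simp add: o_def)
    qed
    show "\<sigma> a = b" if "(a, b) \<in> set l" for a b using that R(2) \<sigma>_eq by blast
  qed
qed

lemma pres_inv:
  assumes "bij \<sigma>" "pres 0 \<sigma>"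
  shows "pres 0 (inv \<sigma>)"
  unfolding pres_def
proof (intro allI impI)
  fix xs :: "nat list" and r assume xs: "distinct xs" "ar r \<le> length xs"
  have "distinct (map (inv \<sigma>) xs)"
    using xs(1) bij_imp_bij_inv[OF assms(1)] by (auto simp: distinct_map bij_def inj_on_def)
  then have "close r (col (map \<sigma> (map (inv \<sigma>) xs))) (0 + col (map (inv \<sigma>) xs))"
    using assms(2) xs unfolding pres_def by (metis length_map)
  moreover have "map \<sigma> (map (inv \<sigma>) xs) = xs"
    using assms(1) by (auto simp: bij_is_surj surj_f_inv_f intro: map_idI)
  ultimately show "close r (col (map (inv \<sigma>) xs)) (0 + col xs)" by (simp add: close_sym)
qed

lemma pres_id: "pres 0 id"
  by (simp add: pres_def)

lemma pres_comp:
  assumes "pres g \<sigma>" "pres h \<tau>" "inj \<tau>"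
  shows "pres (g + h) (\<sigma> \<circ> \<tau>)"
  unfolding pres_def
proof (intro allI impI)
  fix xs :: "nat list" and r assume xs: "distinct xs" "ar r \<le> length xs"
  have "distinct (map \<tau> xs)"
    using xs(1) inj_on_subset[OF assms(3)] by (simp add: distinct_map)
  then have "close r (col (map \<sigma> (map \<tau> xs))) (g + col (map \<tau> xs))"
    using assms(1) xs unfolding pres_def by (metis length_map)
  also have "close r (g + col (map \<tau> xs)) (g + (h + col xs))"
    using assms(2) xs unfolding pres_def by simp
  finally show "close r (col (map (\<sigma> \<circ> \<tau>) xs)) (g + h + col xs)" by (simp add: add.assoc)
qed

lemma pres_act: "pres g (act g)"
  by (simp add: pres_def close_col_act)

lemma inj_act: "inj (act g)"
  by (metis act_minus(1) injI)

lemma pres_zc: "pres g \<sigma> \<Longrightarrow> pres (g + zc) \<sigma>"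
  unfolding pres_def by (meson close_add_right close_add_zc(2) close_trans)

section \<open>Uniqueness and limits of shifts\<close>

lemma pres_close:
  assumes "distinct xs" "ar r \<le> length xs" "close r (col (map \<sigma> xs)) (g + col xs)"
    "close r (col (map \<sigma> xs)) (h + col xs)"
  shows "close r g h"
proof -
  have "close r (g + col xs) (h + col xs)" using assms close_sym close_trans by blast
  then show ?thesis by simp
qed

lemma pres_unique:
  assumes "pres g \<sigma>" "pres h \<sigma>"
  shows "g = h \<or> g = h + zc"
  by (rule close_all, rule pres_close[of "[0..<ar r]" r \<sigma> for r])
    (use assms in \<open>auto simp: pres_def\<close>)

text \<open>The shifts of finite approximations, read off on initial segments of length
  \<open>ar r\<close>, are coherent, and \<open>close_limit\<close> provides the limit. An arbitrary
  list is compared with an initial segment through an approximation valid on both.\<close>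

lemma pres_limit:
  assumes "\<And>F. finite F \<Longrightarrow> \<exists>\<tau> g. pres g \<tau> \<and> (\<forall>x\<in>F. \<tau> x = \<sigma> x)"
  shows "\<exists>g. pres g \<sigma>"
proof -
  have loc: "\<exists>g. \<forall>xs r. set xs \<subseteq> F \<longrightarrow> distinct xs \<longrightarrow> ar r \<le> length xs \<longrightarrow>
      close r (col (map \<sigma> xs)) (g + col xs)" if F: "finite F" for F :: "nat set"
  proof -
    obtain \<tau> g where *: "pres g \<tau>" "\<forall>x\<in>F. \<tau> x = \<sigma> x" using assms[OF F] by blast
    have "map \<sigma> xs = map \<tau> xs" if "set xs \<subseteq> F" for xs using *(2) that by auto
    then show ?thesis using *(1) unfolding pres_def by metis
  qed
  then obtain G where G: "\<And>F xs r. finite F \<Longrightarrow> set xs \<subseteq> F \<Longrightarrow> distinct xs \<Longrightarrow> ar r \<le> length xs \<Longrightarrow>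
      close r (col (map \<sigma> xs)) (G F + col xs)" by metis
  define g where "g r = G {0..<ar r}" for r
  have "close r (g s) (g r)" if "r \<le> s" for r s
    unfolding g_def by (rule pres_close[of "[0..<ar r]"]; (rule G)?) (use ar_mono[OF that] in auto)
  then obtain x where x: "\<And>r. close r x (g r)" using close_limit by blast
  have "pres x \<sigma>"
    unfolding pres_def
  proof (intro allI impI)
    fix xs :: "nat list" and r assume xs: "distinct xs" "ar r \<le> length xs"
    let ?F = "set xs \<union> {0..<ar r}"
    have "close r (G ?F) (g r)"
      unfolding g_def by (rule pres_close[of "[0..<ar r]"]; (rule G)?) auto
    then have "close r (G ?F) x" using x close_sym close_trans by blast
    then have "close r (G ?F + col xs) (x + col xs)" by simp
    moreover have "close r (col (map \<sigma> xs)) (G ?F + col xs)" by (rule G) (use xs in auto)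
    ultimately show "close r (col (map \<sigma> xs)) (x + col xs)" using close_trans by blast
  qed
  then show ?thesis by blast
qed

text \<open>If \<open>d\<close> were moved to \<open>d'\<close>, genericity would yield a further
  point \<open>e\<close> that looks like \<open>d'\<close> over \<open>d\<close>, and so a
  colour-preserving permutation that fixes \<open>d\<close> but sends \<open>d'\<close> to
  \<open>e\<close>.\<close>

lemma pres_centre:
  assumes comm: "\<And>\<tau>. bij \<tau> \<Longrightarrow> pres 0 \<tau> \<Longrightarrow> \<sigma> \<circ> \<tau> = \<tau> \<circ> \<sigma>"
  shows "\<sigma> = id"
proof (rule ccontr)
  assume "\<sigma> \<noteq> id"
  then obtain d where d: "\<sigma> d \<noteq> d" by (auto simp: fun_eq_iff)
  define d' where "d' = \<sigma> d"
  have dd: "d' \<noteq> d" using d by (simp add: d'_def)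
  define p where "p q = col (map (case_option d' id) q)" for q
  obtain e where e: "e \<notin> {d, d'}"
      "\<And>xs r. distinct xs \<Longrightarrow> set xs \<subseteq> {e, d, d'} \<Longrightarrow> e \<in> set xs \<Longrightarrow> ar r \<le> length xs \<Longrightarrow>
        close r (col xs) (p (map (mark e) xs))"
    using col_extension[of "{d, d'}" p] by auto
  have "partial_iso [(d, d), (d', e)]"
    unfolding partial_iso_def
  proof (intro conjI allI impI)
    show "\<forall>z\<in>set [(d, d), (d', e)]. \<forall>z'\<in>set [(d, d), (d', e)]. fst z = fst z' \<longleftrightarrow> snd z = snd z'"
      using e(1) dd by auto
    fix zs r assume zs: "set zs \<subseteq> set [(d, d), (d', e)]" "distinct zs" "ar r \<le> length zs"
    show "close r (col (map snd zs)) (col (map fst zs))"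
    proof (cases "(d', e) \<in> set zs")
      case True
      have "inj_on snd (set zs)" using inj_on_subset[OF _ zs(1), of snd] e(1) by simp
      then have "close r (col (map snd zs)) (p (map (mark e) (map snd zs)))"
        using zs True by (intro e(2)) (force simp: distinct_map)+
      also have "p (map (mark e) (map snd zs)) = col (map fst zs)"
        unfolding p_def map_map
        by (rule arg_cong[where f = col], rule map_cong) (use zs(1) e(1) in \<open>auto simp: mark_def\<close>)
      finally show ?thesis .
    next
      case False
      then have "map snd zs = map fst zs" using zs(1) by auto
      then show ?thesis by (simp only: close_refl)
    qed
  qed
  then obtain \<tau> where \<tau>: "bij \<tau>" "pres 0 \<tau>" "\<tau> d = d" "\<tau> d' = e"
    by (rule partial_iso_total) auto
  have "\<sigma> (\<tau> d) = \<tau> (\<sigma> d)" using comm[OF \<tau>(1,2)] by (metis comp_apply)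
  then show False using \<tau> e(1) by (simp add: d'_def)
qed

section \<open>Two finite covers\<close>

text \<open>The numbers below \<open>p\<close> are the added points and carry a rotation; the
  coloured points are moved up by \<open>p\<close>, so that the cover has the natural numbers as
  domain again.\<close>

definition join :: "nat \<Rightarrow> nat \<Rightarrow> (nat \<Rightarrow> nat) \<Rightarrow> nat \<Rightarrow> nat" where
  "join p t \<sigma> n = (if n < p then (n + t) mod p else \<sigma> (n - p) + p)"

lemma join_comp: "0 < p \<Longrightarrow> join p t \<sigma> \<circ> join p s \<tau> = join p (t + s) (\<sigma> \<circ> \<tau>)"
  by (auto simp: join_def fun_eq_iff mod_add_left_eq mod_add_right_eq ac_simps)

lemma join_cong: "t mod p = s mod p \<Longrightarrow> join p t \<sigma> = join p s \<sigma>"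
  unfolding join_def fun_eq_iff using mod_add_cong[of _ p _ t s] by auto

lemma join_id: "t mod p = 0 \<Longrightarrow> join p t id = id"
  using join_cong[of t p 0] by (auto simp: join_def fun_eq_iff)

lemma join_eq_iff:
  assumes "0 < p"
  shows "join p t \<sigma> = join p s \<tau> \<longleftrightarrow> t mod p = s mod p \<and> \<sigma> = \<tau>"
proof
  assume *: "join p t \<sigma> = join p s \<tau>"
  have "\<sigma> n = \<tau> n" for n using fun_cong[OF *, of "n + p"] by (simp add: join_def)
  moreover have "t mod p = s mod p" using fun_cong[OF *, of 0] assms by (simp add: join_def)
  ultimately show "t mod p = s mod p \<and> \<sigma> = \<tau>" by auto
next
  assume "t mod p = s mod p \<and> \<sigma> = \<tau>"
  then show "join p t \<sigma> = join p s \<tau>" using join_cong[of t p s] by blast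
qed

lemma inj_join:
  assumes "0 < p" "inj \<sigma>"
  shows "inj (join p t \<sigma>)"
proof (rule injI)
  fix m n assume *: "join p t \<sigma> m = join p t \<sigma> n"
  have lt: "join p t \<sigma> k < p \<longleftrightarrow> k < p" for k using assms(1) by (simp add: join_def)
  show "m = n"
  proof (cases "m < p")
    case True
    then have "n < p" using lt[of m] lt[of n] * by simp
    then have "(m + t) mod p = (n + t) mod p" using * True by (simp add: join_def)
    then have "p dvd m - n" "p dvd n - m"
      using mod_eq_dvd_iff_nat[of "n + t" "m + t" p] mod_eq_dvd_iff_nat[of "m + t" "n + t" p]
      by (cases "n \<le> m"; simp)+
    then show ?thesis using True \<open>n < p\<close> by (auto dest!: dvd_imp_le)
  next
    case False
    then have "\<not> n < p" using lt[of m] lt[of n] * by simp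
    then show ?thesis using False * injD[OF assms(2)] by (fastforce simp: join_def)
  qed
qed

text \<open>A homomorphism \<open>\<theta>\<close> to the integers modulo \<open>p\<close>, with values represented by natural numbers. The
  last axiom replaces continuity, which \<open>phi\<close> lacks. It makes the cover closed because \<open>h\<close> and
  \<open>h + zc\<close> shift colours in the same way.\<close>

locale finite_cover =
  fixes p :: nat and \<theta> :: "gel \<Rightarrow> nat"
  assumes p: "0 < p"
    and \<theta>_0: "\<theta> 0 mod p = 0"
    and \<theta>_add: "\<theta> (g + h) mod p = (\<theta> g + \<theta> h) mod p"
    and \<theta>_zc: "\<theta> (g + zc) mod p \<noteq> \<theta> g mod p"
    and \<theta>_close: "close 1 g h \<Longrightarrow> \<theta> g mod p = \<theta> h mod p \<or> \<theta> g mod p = \<theta> (h + zc) mod p"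
begin

definition emb :: "(nat \<Rightarrow> nat) \<times> gel \<Rightarrow> nat \<Rightarrow> nat" where
  "emb m = join p (\<theta> (snd m)) (fst m)"

end

text \<open>A map determines its shift only up to \<open>zc\<close>; the pair records a choice. This
  abstract double cover of the monoid of colour-shifting injections is the common source of both
  covers.\<close>

definition mon :: "((nat \<Rightarrow> nat) \<times> gel) set" where
  "mon = {(\<sigma>, g). inj \<sigma> \<and> pres g \<sigma>}"

definition mmul :: "(nat \<Rightarrow> nat) \<times> gel \<Rightarrow> (nat \<Rightarrow> nat) \<times> gel \<Rightarrow> (nat \<Rightarrow> nat) \<times> gel" where
  "mmul m m' = (fst m \<circ> fst m', snd m + snd m')"

lemma mmul_mem: "m \<in> mon \<Longrightarrow> m' \<in> mon \<Longrightarrow> mmul m m' \<in> mon"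
  by (auto simp: mon_def mmul_def inj_compose pres_comp)

context finite_cover
begin

abbreviation "E \<equiv> emb ` mon"

lemma emb_mmul: "emb m \<circ> emb m' = emb (mmul m m')"
  unfolding emb_def mmul_def join_comp[OF p] by (simp add: join_cong[OF \<theta>_add])

text \<open>\<open>\<theta>\<close> separates the two possible shifts \<open>g\<close> and
  \<open>g + zc\<close> of one map.\<close>

lemma inj_emb: "inj_on emb mon"
proof (rule inj_onI)
  fix m m' assume "m \<in> mon" "m' \<in> mon" "emb m = emb m'"
  then obtain \<sigma> g g' where *: "m = (\<sigma>, g)" "m' = (\<sigma>, g')" "pres g \<sigma>" "pres g' \<sigma>" "\<theta> g mod p = \<theta> g' mod p"
    by (cases m; cases m') (auto simp: emb_def mon_def join_eq_iff[OF p])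
  then show "m = m'" using pres_unique[OF *(3,4)] \<theta>_zc by auto
qed

lemma join_0_mem:
  assumes "inj \<sigma>" "pres 0 \<sigma>"
  shows "join p 0 \<sigma> \<in> E"
proof
  show "(\<sigma>, 0) \<in> mon" using assms by (simp add: mon_def)
  show "join p 0 \<sigma> = emb (\<sigma>, 0)" using join_cong[of 0 p "\<theta> 0"] \<theta>_0 by (simp add: emb_def)
qed

text \<open>The coloured part of a limit shifts the colours by some \<open>g\<close>, but
  \<open>\<theta> g\<close> may differ from the limit rotation. An approximation whose shift is
  \<open>close 1\<close> to \<open>g\<close> has the right rotation, so by
  \<open>\<theta>_close\<close> either \<open>g\<close> or \<open>g + zc\<close> has it.\<close>

lemma limit_mem:
  assumes lim: "\<And>F. finite F \<Longrightarrow> \<exists>e'\<in>E. \<forall>x\<in>F. e' x = e x"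
  shows "e \<in> E"
proof -
  \<comment> \<open>The image of the first added point reads off the rotation.\<close>
  define t where "t = e 0"
  define \<sigma> where "\<sigma> n = e (n + p) - p" for n
  have loc: "\<exists>\<tau> g. inj \<tau> \<and> pres g \<tau> \<and> (\<forall>n\<in>F. \<tau> n = \<sigma> n \<and> e (n + p) = \<sigma> n + p) \<and> t = \<theta> g mod p \<and>
      (\<forall>i<p. e i = (i + t) mod p)" if F: "finite F" for F
  proof -
    obtain e' where e': "e' \<in> E" "\<forall>x\<in>{..<p} \<union> (\<lambda>n. n + p) ` F. e' x = e x"
      using lim[of "{..<p} \<union> (\<lambda>n. n + p) ` F"] F by auto
    then obtain \<tau> g where \<tau>: "inj \<tau>" "pres g \<tau>" "e' = join p (\<theta> g) \<tau>"
      by (auto simp: emb_def mon_def)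
    have e1: "e i = (i + \<theta> g) mod p" if "i < p" for i
      using bspec[OF e'(2), of i] that by (simp add: \<tau>(3) join_def)
    then have t: "t = \<theta> g mod p" using p by (simp add: t_def)
    have "e (n + p) = \<tau> n + p" if "n \<in> F" for n
      using bspec[OF e'(2), of "n + p"] that by (simp add: \<tau>(3) join_def)
    then have "\<forall>n\<in>F. \<tau> n = \<sigma> n \<and> e (n + p) = \<sigma> n + p" by (simp add: \<sigma>_def)
    moreover have "\<forall>i<p. e i = (i + t) mod p" using e1 t by (simp add: mod_add_right_eq)
    ultimately show ?thesis using \<tau> t by blast
  qed
  have e: "e = join p t \<sigma>"
  proof
    fix n
    show "e n = join p t \<sigma> n" using loc[of "{n - p}"] by (auto simp: join_def)
  qed
  have "inj \<sigma>"
  proof (rule injI)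
    fix m n assume mn: "\<sigma> m = \<sigma> n"
    obtain \<tau> where "inj \<tau>" "\<tau> m = \<sigma> m" "\<tau> n = \<sigma> n" using loc[of "{m, n}"] by auto
    then show "m = n" using mn by (metis injD)
  qed
  obtain g where g: "pres g \<sigma>" using pres_limit[of \<sigma>] loc by meson
  \<comment> \<open>The list \<open>[0..<ar 1]\<close> is long enough to determine a shift up to
    \<open>close 1\<close>.\<close>
  obtain \<tau> g' where g': "pres g' \<tau>" "\<forall>n\<in>{0..<ar 1}. \<tau> n = \<sigma> n" "t = \<theta> g' mod p"
    using loc[of "{0..<ar 1}"] by blast
  have eq: "map \<tau> [0..<ar 1] = map \<sigma> [0..<ar 1]" using g'(2) by simp
  have "close 1 (col (map \<tau> [0..<ar 1])) (g' + col [0..<ar 1])"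
    by (rule presD[OF g'(1)]) auto
  then have c: "close 1 (col (map \<sigma> [0..<ar 1])) (g' + col [0..<ar 1])" by (simp only: eq)
  have "close 1 (col (map \<sigma> [0..<ar 1])) (g + col [0..<ar 1])"
    by (rule presD[OF g]) auto
  with c have "close 1 g' g" by (rule pres_close[rotated 2]) auto
  then obtain h where h: "pres h \<sigma>" "\<theta> h mod p = t"
    using \<theta>_close g'(3) g pres_zc by metis
  have "e = emb (\<sigma>, h)" unfolding e emb_def fst_conv snd_conv by (rule join_cong) (use h in auto)
  then show ?thesis using \<open>inj \<sigma>\<close> h by (auto simp: mon_def)
qed

sublocale closed_monoid E
proof
  show "id \<in> E" using join_0_mem[of id] pres_id join_id[of 0 p] by simp
  show "e \<circ> e' \<in> E" if "e \<in> E" "e' \<in> E" for e e'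
    using that mmul_mem by (auto simp: emb_mmul)
  show "inj e" if "e \<in> E" for e
    using that inj_join[OF p] by (auto simp: emb_def mon_def)
qed (rule limit_mem)

text \<open>Precision \<open>n\<close> is enough for colours, since lists of length at most
  \<open>n\<close> are compared only at precisions below \<open>n\<close>. Truncated subtraction
  sends added points to 0, which merely refines the invariant.\<close>

definition invt :: "nat \<Rightarrow> nat list \<Rightarrow> nat list \<times> (nat \<times> nat) set \<times> (nat list \<times> nat set \<times> (nat \<times> nat) set) set" where
  "invt n xs = (map (min p) xs, {(i, j). i < n \<and> j < n \<and> xs ! i = xs ! j},
     (\<lambda>q. (q, key n (col (map (\<lambda>i. xs ! i - p) q)))) ` {q. set q \<subseteq> {..<n} \<and> length q \<le> n})"

lemma finite_invt: "finite (invt n ` tup n UNIV)"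
proof (rule finite_subset)
  let ?Q = "{q. set q \<subseteq> {..<n} \<and> length q \<le> n}"
  show "invt n ` tup n UNIV \<subseteq> {ys. set ys \<subseteq> {..p} \<and> length ys = n} \<times> Pow ({..<n} \<times> {..<n}) \<times>
      Pow (?Q \<times> range (key n))"
    by (auto simp: invt_def tup_def)
  have "finite ?Q" by (rule finite_lists_length_le) simp
  then show "finite ({ys. set ys \<subseteq> {..p} \<and> length ys = n} \<times> Pow ({..<n} \<times> {..<n}) \<times>
      Pow (?Q \<times> range (key n)))"
    using finite_key by (intro finite_cartesian_product) (simp_all add: finite_lists_length_eq)
qed

text \<open>The tuples have the same added points, so rotation 0 is right for these. The remaining
  entries form a finite map that preserves colours because the keys agree, and homogeneity extends
  it.\<close>

lemma invt_orbit:
  assumes xs: "length xs = n" and ys: "length ys = n" and eq: "invt n xs = invt n ys"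
  shows "\<exists>h. automorphism S A h \<and> ys = map h xs"
proof -
  have min: "min p (xs ! i) = min p (ys ! i)" if "i < n" for i
    using eq xs ys that by (auto simp: invt_def dest!: arg_cong[where f = "\<lambda>l. l ! i"])
  then have ge: "p \<le> xs ! i \<longleftrightarrow> p \<le> ys ! i" if "i < n" for i
    using that by (metis min.absorb_iff1)
  have "(i, j) \<in> fst (snd (invt n xs)) \<longleftrightarrow> (i, j) \<in> fst (snd (invt n ys))" for i j using eq by simp
  then have same: "xs ! i = xs ! j \<longleftrightarrow> ys ! i = ys ! j" if "i < n" "j < n" for i j
    using that by (auto simp: invt_def)
  have key: "key n (col (map (\<lambda>i. xs ! i - p) q)) = key n (col (map (\<lambda>i. ys ! i - p) q))"
    if "set q \<subseteq> {..<n}" "length q \<le> n" for q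
  proof -
    have "(q, key n (col (map (\<lambda>i. xs ! i - p) q))) \<in> snd (snd (invt n xs))"
      using that by (auto simp: invt_def)
    then have "(q, key n (col (map (\<lambda>i. xs ! i - p) q))) \<in> snd (snd (invt n ys))" using eq by simp
    then show ?thesis by (auto simp: invt_def)
  qed
  define l where "l = map (\<lambda>i. (xs ! i - p, ys ! i - p)) (filter (\<lambda>i. p \<le> xs ! i) [0..<n])"
  have l: "z \<in> set l \<longleftrightarrow> (\<exists>i<n. p \<le> xs ! i \<and> z = (xs ! i - p, ys ! i - p))" for z
    by (auto simp: l_def)
  have "partial_iso l"
    unfolding partial_iso_def
  proof (intro conjI ballI allI impI)
    fix z z' assume "z \<in> set l" "z' \<in> set l"
    then obtain i j where ij: "i < n" "p \<le> xs ! i" "z = (xs ! i - p, ys ! i - p)"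
        "j < n" "p \<le> xs ! j" "z' = (xs ! j - p, ys ! j - p)" by (auto simp: l)
    then show "fst z = fst z' \<longleftrightarrow> snd z = snd z'"
      using same[of i j] ge[of i] ge[of j] by auto
  next
    fix zs r assume zs: "set zs \<subseteq> set l" "distinct zs" "ar r \<le> length zs"
    have "\<forall>z\<in>set zs. \<exists>i<n. z = (xs ! i - p, ys ! i - p)" using zs(1) l by blast
    then obtain ix where ix: "\<And>z. z \<in> set zs \<Longrightarrow> ix z < n \<and> z = (xs ! ix z - p, ys ! ix z - p)"
      by metis
    define q where "q = map ix zs"
    have "inj_on ix (set zs)" by (rule inj_onI) (metis ix)
    then have dq: "distinct q" using zs(2) by (simp add: q_def distinct_map)
    have sq: "set q \<subseteq> {..<n}" using ix by (auto simp: q_def)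
    have lq: "length q \<le> n" using card_mono[OF _ sq] dq by (simp add: distinct_card)
    have "map fst zs = map (\<lambda>i. xs ! i - p) q" "map snd zs = map (\<lambda>i. ys ! i - p) q"
      unfolding q_def map_map by (intro map_cong refl; metis comp_apply fst_conv snd_conv ix)+
    then have "close n (col (map snd zs)) (col (map fst zs))"
      using key[OF sq lq] by (intro close_if_key) simp
    moreover have "r \<le> n" using less_ar[of r] zs(3) lq by (simp add: q_def)
    ultimately show "close r (col (map snd zs)) (col (map fst zs))" by (rule close_mono)
  qed
  then obtain \<sigma> where \<sigma>: "bij \<sigma>" "pres 0 \<sigma>" "\<And>a b. (a, b) \<in> set l \<Longrightarrow> \<sigma> a = b"
    by (rule partial_iso_total) auto
  let ?h = "join p 0 \<sigma>" and ?k = "join p 0 (inv \<sigma>)"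
  have hk: "?h \<circ> ?k = id" "?k \<circ> ?h = id"
    using \<sigma>(1) join_id[of 0 p] by (simp_all add: join_comp[OF p] bij_def surj_iff)
  then have "bij ?h" by (rule o_bij[rotated])
  moreover have "inv ?h = ?k" using hk by (simp add: inv_unique_comp)
  moreover have "?h \<in> E" "?k \<in> E"
    using \<sigma> pres_inv bij_imp_bij_inv[of \<sigma>] by (auto intro!: join_0_mem simp: bij_is_inj)
  ultimately have "automorphism S A ?h" by (intro automorphismI) auto
  moreover have "ys = map ?h xs"
  proof (rule nth_equalityI)
    fix i assume "i < length ys"
    then have i: "i < n" using ys by simp
    show "ys ! i = map ?h xs ! i"
    proof (cases "p \<le> xs ! i")
      case True
      then have "(xs ! i - p, ys ! i - p) \<in> set l" using i by (auto simp: l)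
      then have "\<sigma> (xs ! i - p) = ys ! i - p" by (rule \<sigma>(3))
      then show ?thesis using True ge[OF i] i xs by (simp add: join_def)
    next
      case False
      then show ?thesis using min[OF i] ge[OF i] i xs by (simp add: join_def)
    qed
  qed (use xs ys in simp)
  ultimately show ?thesis by blast
qed

lemma omega_categorical_A: "omega_categorical S A"
proof -
  interpret orbit_finite S A invt
    by standard
      (use countable_orbit_structure[of E] finite_invt invt_orbit in
        \<open>auto simp: countable_structure_def tup_def\<close>)
  show ?thesis by (rule omega_categorical)
qed

end

section \<open>The two clones and their comparison\<close>

interpretation A: finite_cover 4 gbar
proof
  show "gbar (g + zc) mod 4 \<noteq> gbar g mod 4" for g
    by (cases "gv g 0"; cases "gm g 0 0"; simp add: gbar_def)
  show "close 1 g h \<Longrightarrow> gbar g mod 4 = gbar h mod 4 \<or> gbar g mod 4 = gbar (h + zc) mod 4" for g h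
    using gbar_close by metis
qed (simp_all add: gbar_add gbar_def)

interpretation B: finite_cover 2 phi
proof
  show "phi 0 mod 2 = 0" using phi_add[of 0 0] by simp
  show "phi (g + zc) mod 2 \<noteq> phi g mod 2" for g
    by (cases "lam (gm g)"; simp add: phi_def lam_gm_add lam_gm_zc)
  show "phi g mod 2 = phi h mod 2 \<or> phi g mod 2 = phi (h + zc) mod 2" for g h
    using phi_add_zc by metis
qed (simp_all add: phi_add)

text \<open>Both monoids are faithful copies of \<open>mon\<close>.\<close>

lemma covers_isomorphic: "\<exists>\<xi>. clone_iso UNIV (unary_clone A.E) UNIV (unary_clone B.E) \<xi>"
proof (rule clone_iso_unary_clone)
  let ?\<psi> = "B.emb \<circ> inv_into mon A.emb"
  show "bij_betw ?\<psi> A.E B.E"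
    using A.inj_emb B.inj_emb
    by (intro bij_betw_trans[of _ _ mon] bij_betw_inv_into) (auto simp: bij_betw_def)
  have \<psi>: "?\<psi> (A.emb m) = B.emb m" if "m \<in> mon" for m
    using that A.inj_emb by simp
  show "?\<psi> (e \<circ> f) = ?\<psi> e \<circ> ?\<psi> f" if ef: "e \<in> A.E" "f \<in> A.E" for e f
  proof -
    obtain m m' where "e = A.emb m" "f = A.emb m'" "m \<in> mon" "m' \<in> mon" using ef by blast
    then show ?thesis by (simp only: A.emb_mmul B.emb_mmul \<psi> mmul_mem)
  qed
qed (use A.comp_mem A.inj_mem B.inj_mem in blast)+

lemma covers_not_homeomorphic:
  assumes iso: "clone_iso UNIV (unary_clone A.E) UNIV (unary_clone B.E) \<xi>"
    and homeo: "homeomorphic_map (clone_topology UNIV (unary_clone A.E)) (clone_topology UNIV (unary_clone B.E)) \<xi>"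
  shows False
proof -
  obtain \<psi> where bij: "bij_betw \<psi> A.E B.E" and \<xi>: "\<And>e. e \<in> A.E \<Longrightarrow> \<xi> (unary_op e) = unary_op (\<psi> e)"
    and hom': "\<And>e f. e \<in> A.E \<Longrightarrow> f \<in> A.E \<Longrightarrow> e \<circ> f \<in> A.E \<Longrightarrow> \<psi> (e \<circ> f) = \<psi> e \<circ> \<psi> f"
    using clone_iso_unary[OF iso] by blast
  have hom: "\<psi> (e \<circ> f) = \<psi> e \<circ> \<psi> f" if "e \<in> A.E" "f \<in> A.E" for e f
    by (rule hom'[OF that A.comp_mem[OF that]])
  have \<psi>B: "\<exists>t \<tau>. \<psi> e = join 2 t \<tau>" if "e \<in> A.E" for e
  proof -
    have "\<psi> e \<in> B.E" using bij that by (auto simp: bij_betw_def)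
    then show ?thesis by (auto simp: B.emb_def)
  qed
  \<comment> \<open>Doubling a rotation modulo 2 gives the trivial one.\<close>
  have square: "\<exists>\<tau>. \<psi> (e \<circ> e) = join 2 0 \<tau>" if e: "e \<in> A.E" for e
  proof -
    obtain t \<tau> where "\<psi> e = join 2 t \<tau>" using \<psi>B[OF e] by blast
    then have "\<psi> (e \<circ> e) = join 2 (t + t) (\<tau> \<circ> \<tau>)"
      by (simp only: hom[OF e e] join_comp zero_less_numeral)
    also have "\<dots> = join 2 0 (\<tau> \<circ> \<tau>)" by (rule join_cong) simp
    finally show ?thesis by blast
  qed
  \<comment> \<open>The central swap of the two added points.\<close>
  define w where "w = join 2 1 id"
  have "w = B.emb (id, zc)"
    unfolding w_def B.emb_def using phi_zc by (auto intro!: join_cong)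
  moreover have "(id, zc) \<in> mon" using pres_zc[OF pres_id] by (simp add: mon_def)
  ultimately have wB: "w \<in> B.E" by blast
  then have "w \<in> \<psi> ` A.E" by (simp only: bij_betw_imp_surj_on[OF bij])
  then obtain u where u: "u \<in> A.E" "\<psi> u = w" by (metis (no_types, lifting) image_iff[of w \<psi>])
  then obtain \<sigma> g where \<sigma>: "pres g \<sigma>" "u = join 4 (gbar g) \<sigma>"
    by (auto simp: A.emb_def mon_def)
  \<comment> \<open>\<open>w\<close> commutes with every \<open>join 2 t \<rho>\<close>, so its
    preimage \<open>u\<close> commutes with the whole first monoid, in particular with the maps
    \<open>join 4 0 \<tau>\<close>.\<close>
  have "\<sigma> = id"
  proof (rule pres_centre)
    fix \<tau> assume \<tau>: "bij \<tau>" "pres 0 \<tau>"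
    let ?e = "join 4 0 \<tau>"
    have e: "?e \<in> A.E" using \<tau> by (intro A.join_0_mem bij_is_inj)
    obtain t \<rho> where "\<psi> ?e = join 2 t \<rho>" using \<psi>B e by blast
    then have "\<psi> (u \<circ> ?e) = \<psi> (?e \<circ> u)"
      by (simp add: hom[OF u(1) e] hom[OF e u(1)] u(2) w_def join_comp add.commute)
    then have "u \<circ> ?e = ?e \<circ> u"
      using bij A.comp_mem[OF u(1) e] A.comp_mem[OF e u(1)] unfolding bij_betw_def by (metis inj_onD)
    then show "\<sigma> \<circ> \<tau> = \<tau> \<circ> \<sigma>" by (simp add: \<sigma>(2) join_comp join_eq_iff)
  qed
  \<comment> \<open>Otherwise \<open>u\<close> would be the identity, which is a square, whereas
    images of squares do not swap.\<close>
  have "g \<noteq> 0"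
  proof
    assume "g = 0"
    then have "u = id" using \<sigma> \<open>\<sigma> = id\<close> A.\<theta>_0 join_id by simp
    then obtain \<tau> where "w = join 2 0 \<tau>" using square[OF u(1)] u by auto
    then show False by (simp add: w_def join_eq_iff)
  qed
  then have "g = zc" using pres_unique[of g id 0] pres_id \<sigma> \<open>\<sigma> = id\<close> by simp
  then have u_eq: "u = join 4 (gbar zc) id" using \<sigma> \<open>\<sigma> = id\<close> by simp
  \<comment> \<open>Products of squares in the first monoid that converge to
    \<open>u\<close>.\<close>
  define s where "s k = join 4 (gbar (diag k)) (act (diag k))" for k
  have emb_act: "join 4 (gbar g) (act g) \<in> A.E" for g
    by (rule image_eqI[of _ _ "(act g, g)"]) (simp_all add: A.emb_def mon_def inj_act pres_act)
  have s: "s k \<in> A.E" for k unfolding s_def by (rule emb_act)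
  have sq: "\<exists>\<tau>. \<psi> (s k) = join 2 0 \<tau>" for k
  proof (induction k)
    case 0
    have "act 0 = id" by auto
    then have "s 0 = id" unfolding s_def diag_0 using join_id[OF A.\<theta>_0] by simp
    then show ?case using square[OF A.id_mem] by (simp only: id_comp)
  next
    case (Suc k)
    let ?f = "join 4 (gbar (unit_vec k)) (act (unit_vec k))"
    have act: "act (g + h) = act g \<circ> act h" for g h by (auto simp: act_add)
    have "s k \<circ> (?f \<circ> ?f) = join 4 (gbar (diag k) + (gbar (unit_vec k) + gbar (unit_vec k))) (act (diag (Suc k)))"
      by (simp add: s_def join_comp diag_Suc act)
    also have "\<dots> = s (Suc k)"
      unfolding s_def diag_Suc
      by (rule join_cong) (metis gbar_add mod_add_right_eq)
    finally have eq: "s (Suc k) = s k \<circ> (?f \<circ> ?f)" by simp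
    obtain \<tau> where \<tau>: "\<psi> (s k) = join 2 0 \<tau>" using Suc by blast
    obtain \<rho> where \<rho>: "\<psi> (?f \<circ> ?f) = join 2 0 \<rho>" using square[OF emb_act] by blast
    have "\<psi> (s (Suc k)) = join 2 0 \<tau> \<circ> join 2 0 \<rho>"
      unfolding eq using hom[OF s A.comp_mem[OF emb_act emb_act]] \<tau> \<rho> by simp
    then show ?case by (simp add: join_comp) blast
  qed
  have "\<forall>\<^sub>F k in sequentially. s k x = u x" for x
  proof -
    \<comment> \<open>\<open>Suc\<close> ensures \<open>0 < k\<close>, which
      \<open>gbar_diag\<close> needs even at level 0.\<close>
    have "s k x = u x" if k: "k \<ge> Suc (lvl (x - 4))" for k
    proof -
      have "act (diag k) (x - 4) = act 0 (x - 4)"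
        by (rule act_cong, rule close_diag) (use k in simp)
      moreover have "gbar (diag k) = gbar zc" using k by (intro gbar_diag) simp
      ultimately show ?thesis by (simp add: s_def u_eq join_def)
    qed
    then show ?thesis unfolding eventually_sequentially by blast
  qed
  from limitin_unary_op[OF s u(1) this]
  have "limitin (clone_topology UNIV (unary_clone B.E)) (\<xi> \<circ> (\<lambda>k. unary_op (s k))) (\<xi> (unary_op u)) sequentially"
    using homeomorphic_imp_continuous_map[OF homeo] by (rule continuous_map_limit[rotated])
  then have lim: "limitin (clone_topology UNIV (unary_clone B.E)) (\<lambda>k. unary_op (\<psi> (s k))) (unary_op w) sequentially"
    using \<xi> s u by (simp add: o_def)
  \<comment> \<open>A neighbourhood of \<open>w\<close>: the unary operations sending the added
    point 0 to the added point 1. By \<open>sq\<close> it contains no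
    \<open>unary_op (\<psi> (s k))\<close>.\<close>
  let ?U = "{F \<in> unary_clone B.E \<inter> operations UNIV. fst F = 1 \<and> snd F (\<lambda>i\<in>{..<1}. 0) = (1 :: nat)}"
  have "unary_op w \<in> operations UNIV"
    by (auto simp: operations_def unary_op_def)
  moreover have "w 0 = 1" by (simp add: w_def join_def)
  ultimately have "unary_op w \<in> ?U"
    using unary_op_mem[OF wB] unary_op_apply[of w 0] by (simp add: unary_op_def)
  then have "\<forall>\<^sub>F k in sequentially. unary_op (\<psi> (s k)) \<in> ?U"
    using lim openin_unary_value[of "unary_clone B.E" 0 1] unfolding limitin_def by blast
  then have "\<exists>k. unary_op (\<psi> (s k)) \<in> ?U"
    by (auto dest: eventually_happens)
  then obtain k where "unary_op (\<psi> (s k)) \<in> ?U" ..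
  then have "\<psi> (s k) 0 = 1" using unary_op_apply[of "\<psi> (s k)" 0] by simp
  moreover obtain \<tau> where "\<psi> (s k) = join 2 0 \<tau>" using sq by blast
  ultimately show False by (simp add: join_def)
qed

theorem corollary1p2:
  shows "\<exists>(S :: (nat, nat) signature) (A :: (nat, nat, nat) struct)
          (T :: (nat, nat) signature) (B :: (nat, nat, nat) struct).
     countable_structure S A \<and> omega_categorical S A \<and>
     countable_structure T B \<and> omega_categorical T B \<and>
     (\<exists>\<xi>. clone_iso (universe A) (Pol S A) (universe B) (Pol T B) \<xi>) \<and>
     \<not> (\<exists>\<xi>. clone_iso (universe A) (Pol S A) (universe B) (Pol T B) \<xi> \<and>
           homeomorphic_map (clone_topology (universe A) (Pol S A))
             (clone_topology (universe B) (Pol T B)) \<xi>)"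
proof (rule exI[of _ orbit_signature], rule exI[of _ "orbit_structure A.E"],
    rule exI[of _ orbit_signature], rule exI[of _ "orbit_structure B.E"], intro conjI)
  show "countable_structure orbit_signature (orbit_structure A.E)"
    "countable_structure orbit_signature (orbit_structure B.E)"
    by (rule countable_orbit_structure)+
  show "omega_categorical orbit_signature (orbit_structure A.E)"
    by (rule A.omega_categorical_A)
  show "omega_categorical orbit_signature (orbit_structure B.E)"
    by (rule B.omega_categorical_A)
  show "\<exists>\<xi>. clone_iso (universe (orbit_structure A.E)) (Pol orbit_signature (orbit_structure A.E))
      (universe (orbit_structure B.E)) (Pol orbit_signature (orbit_structure B.E)) \<xi>"
    using covers_isomorphic by (simp add: A.Pol_eq B.Pol_eq)
  show "\<not> (\<exists>\<xi>. clone_iso (universe (orbit_structure A.E)) (Pol orbit_signature (orbit_structure A.E))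
      (universe (orbit_structure B.E)) (Pol orbit_signature (orbit_structure B.E)) \<xi> \<and>
      homeomorphic_map (clone_topology (universe (orbit_structure A.E)) (Pol orbit_signature (orbit_structure A.E)))
        (clone_topology (universe (orbit_structure B.E)) (Pol orbit_signature (orbit_structure B.E))) \<xi>)"
    using covers_not_homeomorphic by (auto simp: A.Pol_eq B.Pol_eq)
qed

end
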